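(* For a positive integer $k$, let $N_k$ be the maximum size of a $k$-nice set. There exists $k_0$ such that for every integer $k\ge k_0$, \[ N_k = \begin{cases} k+4 &\text{ if } k \bmod 6 = 2,\\ k+3 &\text{ if } k \bmod 6\in\{1,3,5\},\\ k+2 &\text{ otherwise.} \end{cases} \]
   Context: For a positive integer $k$, a set $Q\subseteq\mathbb{Z}^2$ is $k$-nice if (i) every element $(m,n)\in Q$ is non-zero with $\gcd(m,n)=1$; (ii) $Q$ does not contain both $(m,n)$ and $(-m,-n)$ for any $(m,n)\in\mathbb{Z}^2$; and (iii) $|mn'-m'n|\le k$ for all $(m,n),(m',n')\in Q$. *)

theory Defs
  imports Complex_Main
begin

definition nice :: "nat \<Rightarrow> (int \<times> int) set \<Rightarrow> bool" where
  "nice k Q \<longleftrightarrow>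
     (\<forall>(m, n) \<in> Q. (m, n) \<noteq> (0, 0) \<and> gcd m n = 1) \<and>
     \<not> (\<exists>m n. (m, n) \<in> Q \<and> (- m, - n) \<in> Q) \<and>
     (\<forall>(m, n) \<in> Q. \<forall>(m', n') \<in> Q. \<bar>m * n' - m' * n\<bar> \<le> int k)"

text \<open>For positive \<open>k\<close> the maximum below exists: by \<open>nice_finite\<close> every nice set is finite, so
  \<open>card\<close> is its true size, and by \<open>nice_sizes_finite\<close> and \<open>nice_sizes_nonempty\<close> the set of
  sizes is finite and nonempty, as \<open>Max\<close> requires.\<close>

definition max_nice_size :: "nat \<Rightarrow> nat" where
  "max_nice_size k = Max {card Q | Q. nice k Q}"

lemma primitive_parallel:
  fixes a b c d :: int
  assumes "gcd a b = 1" "gcd c d = 1" "a * d = c * b"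
  shows "(c, d) = (a, b) \<or> (c, d) = (- a, - b)"
proof -
  have "coprime a b" "coprime c d" using assms by (simp_all add: coprime_iff_gcd_eq_1)
  have "a dvd c * b" "d dvd c * b" by (metis assms(3) dvd_triv_left) (metis assms(3) dvd_triv_right)
  then have ac: "a dvd c" and db: "d dvd b"
    using \<open>coprime a b\<close> \<open>coprime c d\<close>
    by (simp_all add: coprime_dvd_mult_left_iff coprime_dvd_mult_right_iff coprime_commute)
  have "c dvd a * d" "b dvd a * d" by (simp_all add: assms(3))
  then have ca: "c dvd a" and bd: "b dvd d"
    using \<open>coprime a b\<close> \<open>coprime c d\<close>
    by (simp_all add: coprime_dvd_mult_left_iff coprime_dvd_mult_right_iff coprime_commute)
  have "\<bar>a\<bar> = \<bar>c\<bar>" "\<bar>b\<bar> = \<bar>d\<bar>" using ac ca bd db zdvd_antisym_abs by blast+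
  then have "c = a \<or> c = - a" "d = b \<or> d = - b" by linarith+
  then show ?thesis using assms(3) by auto
qed

lemma nice_card_bound:
  assumes "nice k Q"
  shows "finite Q \<and> card Q \<le> (2 * k + 1) ^ 2"
proof (cases "\<exists>a b c d. (a, b) \<in> Q \<and> (c, d) \<in> Q \<and> a * d - c * b \<noteq> 0")
  case True
  then obtain a b c d where abcd: "(a, b) \<in> Q" "(c, d) \<in> Q" "a * d - c * b \<noteq> 0" by blast
  define f where "f = (\<lambda>(x, y). (a * y - x * b, c * y - x * d))"
  have inj: "inj_on f Q"
  proof (rule inj_onI)
    fix u v assume "f u = f v"
    obtain x y x' y' where uv: "u = (x, y)" "v = (x', y')" by (metis surj_pair)
    have 1: "a * (y - y') = b * (x - x')" and 2: "c * (y - y') = d * (x - x')"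
      using \<open>f u = f v\<close> by (auto simp: f_def uv algebra_simps)
    have "(a * d - c * b) * (y - y') = d * (a * (y - y')) - b * (c * (y - y'))"
      by (simp add: algebra_simps)
    also have "\<dots> = 0" by (simp only: 1 2) (simp add: algebra_simps)
    finally have y: "y = y'" using abcd(3) by simp
    have "(a * d - c * b) * (x - x') = a * (d * (x - x')) - c * (b * (x - x'))"
      by (simp add: algebra_simps)
    also have "\<dots> = 0" by (simp only: 1[symmetric] 2[symmetric]) (simp add: algebra_simps)
    finally have "x = x'" using abcd(3) by simp
    then show "u = v" using y uv by simp
  qed
  let ?I = "{- int k..int k}"
  have sub: "f ` Q \<subseteq> ?I \<times> ?I"
  proof
    fix z assume "z \<in> f ` Q"
    then obtain x y where xy: "(x, y) \<in> Q" "z = f (x, y)" by auto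
    have "\<bar>a * y - x * b\<bar> \<le> int k" "\<bar>c * y - x * d\<bar> \<le> int k"
      using assms xy(1) abcd unfolding nice_def by blast+
    then show "z \<in> ?I \<times> ?I" by (auto simp: xy f_def)
  qed
  have "card (?I \<times> ?I) = (2 * k + 1) ^ 2"
    by (simp add: card_cartesian_product power2_eq_square nat_add_distrib nat_mult_distrib)
  moreover have "finite (?I \<times> ?I)" by simp
  ultimately show ?thesis
    using inj sub by (metis card_image card_mono finite_imageD finite_subset)
next
  case False
  have prim: "\<And>m n. (m, n) \<in> Q \<Longrightarrow> gcd m n = 1"
    and par: "\<And>a b c d. (a, b) \<in> Q \<Longrightarrow> (c, d) \<in> Q \<Longrightarrow> a * d = c * b"
    and opp: "\<And>m n. (m, n) \<in> Q \<Longrightarrow> (- m, - n) \<notin> Q"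
    subgoal using assms by (auto simp: nice_def)
    subgoal using False by (metis eq_iff_diff_eq_0)
    subgoal using assms by (auto simp: nice_def)
    done
  have "u = v" if uv: "u \<in> Q" "v \<in> Q" for u v
  proof -
    obtain a b c d where e: "u = (a, b)" "v = (c, d)" by (metis surj_pair)
    have "gcd a b = 1" "gcd c d = 1" using uv e by (simp_all add: prim)
    moreover have "a * d = c * b" by (rule par) (use uv e in auto)
    ultimately have "(c, d) = (a, b) \<or> (c, d) = (- a, - b)" by (rule primitive_parallel)
    moreover have "(- a, - b) \<notin> Q" using opp[of a b] uv(1) e(1) by simp
    ultimately show ?thesis using uv e by metis
  qed
  then have "Q = {} \<or> (\<exists>u. Q = {u})" by blast
  then show ?thesis by auto
qed

lemma nice_finite: "nice k Q \<Longrightarrow> finite Q"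
  using nice_card_bound by blast

lemma nice_sizes_finite: "finite {card Q | Q. nice k Q}"
  by (rule finite_subset[of _ "{..(2 * k + 1) ^ 2}"]) (use nice_card_bound in auto)

lemma nice_sizes_nonempty: "{card Q | Q. nice k Q} \<noteq> {}"
proof -
  have "nice k {}" by (simp add: nice_def)
  then show ?thesis by blast
qed

end

theory Submission
  imports Defs "HOL-Number_Theory.Totient" "HOL-Analysis.Kronecker_Approximation_Theorem"
begin

text \<open>
  By Dirichlet approximation a unimodular map and sign changes put a nice set into the strip
  \<open>0 \<le> n \<le> h\<close> with \<open>h\<^sup>2 \<le> 9 k\<close>. Let \<open>L\<^sub>n\<close> be the width of the row at height \<open>n\<close>;
  condition (iii) gives \<open>j L\<^sub>i + i L\<^sub>j \<le> 2 k\<close>, and by the Legendre sieve row \<open>n\<close> has at most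
  \<open>\<phi>(n) L\<^sub>n / n\<close> points, up to an error \<open>O(n\<^bsup>1/3\<^esup>)\<close>. Weighting the inequalities for coprime
  \<open>i, j \<le> h\<close> with \<open>i + j > h\<close> (the pairs of consecutive Farey denominators) by \<open>1 / (i j)\<close>
  shows that the main terms add up to at most \<open>k\<close>. For \<open>h \<ge> 4\<close> these inequalities cannot all be
  tight: the row widths at \<open>p\<close>, \<open>p - d\<close>, \<open>p + d\<close> satisfy conflicting constraints, and the
  resulting saving beats all error terms once \<open>k\<close> is large. For \<open>h \<le> 3\<close> the count is done
  exactly, keeping track of residues modulo 6.
\<close>

section \<open>Counting coprime integers in an interval\<close>

text \<open>Real endpoints and a half-open interval keep the family closed under scaling: for a
  prime \<open>p\<close> outside \<open>P\<close>, dividing the multiples of \<open>p\<close> by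
  \<open>p\<close> turns the endpoints into \<open>x / p\<close> and \<open>y / p\<close>.\<close>

definition sifted :: "nat set \<Rightarrow> real \<Rightarrow> real \<Rightarrow> int set" where
  "sifted P x y = {m. x < real_of_int m \<and> real_of_int m \<le> y \<and> (\<forall>p\<in>P. \<not> int p dvd m)}"

lemma finite_sifted: "finite (sifted P x y)"
proof (rule finite_subset)
  show "sifted P x y \<subseteq> {\<lfloor>x\<rfloor>..\<lfloor>y\<rfloor>}"
    by (auto simp: sifted_def le_floor_iff floor_le_iff)
qed simp

text \<open>Legendre sieve by induction on \<open>P\<close>: a new prime \<open>p\<close> subtracts
  the count for the interval shrunk by \<open>p\<close>, which multiplies the main term by
  \<open>1 - 1 / p\<close> and at most doubles the error bound. With no primes the error comes from
  two floors.\<close>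

lemma card_sifted:
  assumes "finite P" "\<And>p. p \<in> P \<Longrightarrow> prime p" "x \<le> y"
  shows "\<bar>card (sifted P x y) - (y - x) * (\<Prod>p\<in>P. 1 - 1 / p)\<bar> \<le> 2 ^ card P"
  using assms
proof (induction P arbitrary: x y rule: finite_induct)
  case empty
  have "sifted {} x y = {\<lfloor>x\<rfloor>+1..\<lfloor>y\<rfloor>}"
    by (auto simp: sifted_def le_floor_iff) linarith+
  moreover have "\<lfloor>x\<rfloor> \<le> \<lfloor>y\<rfloor>"
    using empty by (simp add: floor_mono)
  ultimately have "real (card (sifted {} x y)) = \<lfloor>y\<rfloor> - \<lfloor>x\<rfloor>"
    by simp
  then show ?case by simp linarith
next
  case (insert p P)
  have p: "prime p" "p > 0" using insert.prems by (auto simp: prime_gt_0_nat)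
  let ?f = "\<lambda>m. int p * m"
  have multiples: "{m \<in> sifted P x y. int p dvd m} = ?f ` sifted P (x / p) (y / p)"
  proof -
    have "int q dvd int p * m \<longleftrightarrow> int q dvd m" if "q \<in> P" for q m
    proof -
      have "prime q" "q \<noteq> p" using that insert by auto
      then have "coprime (int q) (int p)"
        using p by (simp add: primes_coprime)
      then show ?thesis by (simp add: coprime_dvd_mult_right_iff)
    qed
    then have "?f m \<in> sifted P x y \<longleftrightarrow> m \<in> sifted P (x / p) (y / p)" for m
      using p by (auto simp: sifted_def field_simps)
    note mem = this
    show ?thesis
    proof (intro equalityI subsetI)
      fix m assume "m \<in> {m \<in> sifted P x y. int p dvd m}"
      then obtain m' where "m = int p * m'" "m \<in> sifted P x y" by (blast elim: dvdE)
      then show "m \<in> ?f ` sifted P (x / p) (y / p)" using mem by blast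
    next
      fix m assume "m \<in> ?f ` sifted P (x / p) (y / p)"
      then show "m \<in> {m \<in> sifted P x y. int p dvd m}" using mem by auto
    qed
  qed
  have split: "sifted P x y = sifted (insert p P) x y \<union> {m \<in> sifted P x y. int p dvd m}"
    by (auto simp: sifted_def)
  have "card (sifted P x y) = card (sifted (insert p P) x y) + card {m \<in> sifted P x y. int p dvd m}"
    by (subst split, subst card_Un_disjoint) (auto simp: finite_sifted, auto simp: sifted_def)
  also have "card {m \<in> sifted P x y. int p dvd m} = card (sifted P (x / p) (y / p))"
    unfolding multiples using p by (intro card_image inj_onI) auto
  finally have card: "real (card (sifted (insert p P) x y)) =
      real (card (sifted P x y)) - real (card (sifted P (x / p) (y / p)))"
    by simp
  define D where "D = (\<Prod>p\<in>P. 1 - 1 / real p)"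
  have 1: "\<bar>card (sifted P x y) - (y - x) * D\<bar> \<le> 2 ^ card P"
    unfolding D_def using insert by auto
  have 2: "\<bar>card (sifted P (x / p) (y / p)) - (y / p - x / p) * D\<bar> \<le> 2 ^ card P"
    unfolding D_def using insert p by (intro insert.IH) (auto simp: divide_right_mono)
  have "(y - x) * (\<Prod>q\<in>insert p P. 1 - 1 / real q) = (y - x) * D - (y / p - x / p) * D"
    using insert p by (simp add: D_def field_simps)
  moreover have "(2::real) ^ card (insert p P) = 2 ^ card P + 2 ^ card P"
    using insert.hyps by simp
  moreover have "\<bar>a - b - (A - B)\<bar> \<le> e + e"
    if "\<bar>a - A\<bar> \<le> e" "\<bar>b - B\<bar> \<le> e" for a b A B e :: real
    using that by linarith
  ultimately show ?case using 1 2 unfolding card by metis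
qed

lemma coprime_iff_no_prime_factor:
  assumes "n > 0"
  shows "coprime m (int n) \<longleftrightarrow> (\<forall>p\<in>prime_factors n. \<not> int p dvd m)"
proof
  assume m: "coprime m (int n)"
  show "\<forall>p\<in>prime_factors n. \<not> int p dvd m"
  proof (intro ballI notI)
    fix p assume p: "p \<in> prime_factors n" "int p dvd m"
    then have "int p dvd int n" by (auto simp: in_prime_factors_iff)
    then have "is_unit (int p)" using m p coprime_common_divisor by blast
    then show False using p by (auto simp: in_prime_factors_iff)
  qed
next
  assume *: "\<forall>p\<in>prime_factors n. \<not> int p dvd m"
  show "coprime m (int n)"
  proof (rule ccontr)
    assume "\<not> coprime m (int n)"
    then have "nat (gcd m (int n)) \<noteq> 1" by (auto simp: coprime_iff_gcd_eq_1)
    then obtain p where p: "prime p" "p dvd nat (gcd m (int n))" using prime_factor_nat by blast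
    then have "int p dvd gcd m (int n)" by (metis gcd_ge_0_int int_dvd_int_iff nat_0_le)
    then show False using * p assms by (auto simp: in_prime_factors_iff)
  qed
qed

lemma card_coprime:
  assumes "n > 0" "x \<le> y"
  shows "\<bar>card {m. x < real_of_int m \<and> real_of_int m \<le> y \<and> coprime m (int n)} - (y - x) * (totient n / n)\<bar>
    \<le> 2 ^ card (prime_factors n)"
proof -
  have "{m. x < real_of_int m \<and> real_of_int m \<le> y \<and> coprime m (int n)} = sifted (prime_factors n) x y"
    by (auto simp: sifted_def coprime_iff_no_prime_factor[OF \<open>n > 0\<close>])
  then show ?thesis
    using card_sifted[of "prime_factors n" x y] assms
      by (simp add: totient_formula2 in_prime_factors_iff)
qed

text \<open>Sliding the window by one trades \<open>Suc a\<close> for \<open>Suc a + n\<close>,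
  which has the same gcd with \<open>n\<close>.\<close>

lemma card_coprime_period:
  assumes "n > 0"
  shows "card {j \<in> {a<..a + n}. coprime j n} = totient n"
proof (induction a)
  case 0
  have "{j \<in> {0<..0 + n}. coprime j n} = totatives n"
    by (auto simp: totatives_def)
  then show ?case by (simp add: totient_def)
next
  case (Suc a)
  let ?B = "{j \<in> {Suc a<..a + n}. coprime j n}"
  have "{a<..a + n} = insert (Suc a) {Suc a<..a + n}"
    "{Suc a<..Suc a + n} = insert (Suc a + n) {Suc a<..a + n}"
    using assms by auto
  then have "{j \<in> {a<..a + n}. coprime j n} = (if coprime (Suc a) n then insert (Suc a) ?B else ?B)"
    "{j \<in> {Suc a<..Suc a + n}. coprime j n} = (if coprime (Suc a + n) n then insert (Suc a + n) ?B else ?B)"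
    by auto
  moreover have "coprime (Suc a + n) n \<longleftrightarrow> coprime (Suc a) n"
    by (simp only: coprime_iff_gcd_eq_1 gcd_add1)
  ultimately show ?case using Suc by (auto split: if_splits)
qed

text \<open>This is the cubed form of a cube-root bound for two to the number of prime factors. A
  prime factor of at least 8 pays for its own factor 8; those below 8 number at most 8 and cost
  \<open>8 ^ 8\<close>.\<close>

lemma power_card_prime_factors_le:
  fixes n :: nat
  assumes "n > 0"
  shows "8 ^ card (prime_factors n) \<le> 8 ^ 8 * n"
proof -
  let ?P = "prime_factors n"
  have "(8::nat) ^ card ?P = (\<Prod>p\<in>?P. 8)" by simp
  also have "\<dots> = (\<Prod>p\<in>?P \<inter> {..<8}. 8) * (\<Prod>p\<in>?P - {..<8}. 8)"
    by (rule prod.Int_Diff) simp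
  also have "\<dots> \<le> 8 ^ 8 * (\<Prod>p\<in>?P - {..<8}. p)"
  proof (intro mult_mono prod_mono)
    have "card (?P \<inter> {..<8}) \<le> card {..<8::nat}" by (intro card_mono) auto
    then show "(\<Prod>p\<in>?P \<inter> {..<8}. 8) \<le> (8::nat) ^ 8"
      by (simp only: prod_constant card_lessThan) (rule power_increasing, auto)
  qed auto
  also have "(\<Prod>p\<in>?P - {..<8}. p) \<le> (\<Prod>p\<in>?P. p)"
  proof (rule dvd_imp_le)
    show "\<Prod>(?P - {..<8}) dvd \<Prod>?P" by (rule prod_dvd_prod_subset) auto
    show "0 < \<Prod>?P"
      by (rule prod_pos) (simp add: in_prime_factors_iff prime_gt_0_nat)
  qed
  also have "(\<Prod>p\<in>?P. p) \<le> (\<Prod>p\<in>?P. p ^ multiplicity p n)"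
  proof (rule prod_mono)
    fix p assume p: "p \<in> ?P"
    then have "multiplicity p n > 0" by (simp add: prime_factors_multiplicity)
    then show "0 \<le> p \<and> p \<le> p ^ multiplicity p n"
      using p self_le_power[of p "multiplicity p n"] prime_ge_1_nat[of p] by auto
  qed
  also have "\<dots> = n" using assms by (simp add: prime_factorization_nat[symmetric])
  finally show ?thesis by simp
qed

section \<open>Pairs of consecutive Farey denominators\<close>

definition farey :: "nat \<Rightarrow> (nat \<times> nat) set" where
  "farey h = {(i, j). i \<in> {1..h} \<and> j \<in> {1..h} \<and> coprime i j \<and> h < i + j}"

lemma finite_farey: "finite (farey h)"
  by (rule finite_subset[of _ "{1..h} \<times> {1..h}"]) (auto simp: farey_def)

text \<open>Passing from \<open>h\<close> to \<open>h + 1\<close> replaces the pairs with \<open>i + j = h + 1\<close>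
  by those containing \<open>h + 1\<close>;
  both have the same weight because \<open>1 / (i j) = (1 / i + 1 / j) / (i + j)\<close>.\<close>

lemma sum_farey:
  assumes "h \<ge> 1"
  shows "(\<Sum>(i, j)\<in>farey h. 1 / (real i * real j)) = 1"
  using assms
proof (induction h rule: dec_induct)
  case base
  have "farey 1 = {(1, 1)}" by (auto simp: farey_def)
  then show ?case by simp
next
  case (step h)
  define m where "m = Suc h"
  define C where "C = {i \<in> {1..h}. coprime i m}"
  define f :: "nat \<times> nat \<Rightarrow> real" where "f = (\<lambda>(i, j). 1 / (real i * real j))"
  \<comment> \<open>\<open>D\<close> holds the pairs that leave, \<open>N1\<close> and
    \<open>N2\<close> those that enter; all three are parametrised by \<open>C\<close>, so their
    weights can be compared termwise.\<close>
  define D where "D = (\<lambda>i. (i, m - i)) ` C"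
  define N1 where "N1 = (\<lambda>i. (i, m)) ` C"
  define N2 where "N2 = (\<lambda>i. (m, i)) ` C"
  have fin: "finite C" "finite D" "finite N1" "finite N2"
    by (auto simp: C_def D_def N1_def N2_def)
  have D: "D = {(i, j). i \<ge> 1 \<and> j \<ge> 1 \<and> coprime i j \<and> i + j = m}"
  proof (intro equalityI subsetI)
    fix x assume "x \<in> D"
    then obtain i where i: "x = (i, m - i)" "i \<in> C" by (auto simp: D_def)
    then have "gcd i (i + (m - i)) = 1" by (simp add: C_def m_def coprime_iff_gcd_eq_1)
    then have "coprime i (m - i)" by (simp only: gcd_add2 coprime_iff_gcd_eq_1)
    then show "x \<in> {(i, j). i \<ge> 1 \<and> j \<ge> 1 \<and> coprime i j \<and> i + j = m}"
      using i by (auto simp: C_def m_def)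
  next
    fix x assume "x \<in> {(i, j). i \<ge> 1 \<and> j \<ge> 1 \<and> coprime i j \<and> i + j = m}"
    then obtain i j where x: "x = (i, j)" "i \<ge> 1" "j \<ge> 1" "coprime i j" "i + j = m" by auto
    then have "coprime i m" by (metis coprime_iff_gcd_eq_1 gcd_add2)
    then show "x \<in> D" using x by (auto simp: D_def C_def m_def image_iff)
  qed
  have union: "farey m \<union> D = farey h \<union> (N1 \<union> N2)"
    using step.hyps unfolding D
    by (auto simp: farey_def N1_def N2_def C_def m_def image_iff le_Suc_eq coprime_commute)
  have dis: "farey m \<inter> D = {}" "farey h \<inter> (N1 \<union> N2) = {}" "N1 \<inter> N2 = {}"
    unfolding D by (auto simp: farey_def N1_def N2_def C_def m_def)
  have "sum f (farey m) + sum f D = sum f (farey m \<union> D)"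
    using dis fin by (simp add: sum.union_disjoint finite_farey)
  also have "\<dots> = sum f (farey h) + (sum f N1 + sum f N2)"
    unfolding union using dis fin by (simp add: sum.union_disjoint finite_farey)
  also have "sum f N1 = (\<Sum>i\<in>C. 1 / (real i * m))"
    unfolding N1_def by (subst sum.reindex) (auto simp: inj_on_def f_def)
  also have "sum f N2 = (\<Sum>i\<in>C. 1 / (real i * m))"
    unfolding N2_def by (subst sum.reindex) (auto simp: inj_on_def f_def mult.commute)
  finally have 1: "sum f (farey m) + sum f D = sum f (farey h) + 2 * (\<Sum>i\<in>C. 1 / (real i * m))"
    by simp
  \<comment> \<open>The reflection at \<open>m\<close> permutes \<open>C\<close>, so the two terms
    of the partial fraction decomposition below have equal sums.\<close>
  have refl: "(\<Sum>i\<in>C. 1 / (real (m - i) * m)) = (\<Sum>i\<in>C. 1 / (real i * m))"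
  proof (rule sum.reindex_bij_witness[of _ "\<lambda>i. m - i" "\<lambda>i. m - i"])
    have "m - i \<in> C" if "i \<in> C" for i
      using that by (auto simp: C_def m_def coprime_iff_gcd_eq_1 gcd_diff1_nat)
       (metis Suc_diff_le diff_le_self gcd.commute gcd_diff1_nat gcd_diff2_nat le_SucI)
    then show "\<And>i. i \<in> C \<Longrightarrow> m - i \<in> C" "\<And>i. i \<in> C \<Longrightarrow> m - i \<in> C"
      by blast+
  qed (auto simp: C_def m_def)
  have "sum f D = (\<Sum>i\<in>C. 1 / (real i * real (m - i)))"
    unfolding D_def by (subst sum.reindex) (auto simp: inj_on_def f_def)
  also have "\<dots> = (\<Sum>i\<in>C. 1 / (real i * m) + 1 / (real (m - i) * m))"
  proof (rule sum.cong)
    fix i assume "i \<in> C"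
    then have "real (m - i) = real m - real i" "real i > 0" "real m - real i > 0"
      by (auto simp: C_def m_def)
    then show "1 / (real i * real (m - i)) = 1 / (real i * m) + 1 / (real (m - i) * m)"
      by (simp add: field_simps)
  qed simp
  finally have "sum f D = 2 * (\<Sum>i\<in>C. 1 / (real i * m))"
    by (simp add: sum.distrib refl)
  then have "sum f (farey m) = sum f (farey h)" using 1 by simp
  then show ?case using step.IH by (simp add: f_def m_def)
qed

text \<open>The partners of \<open>n\<close> are the integers coprime to \<open>n\<close> in the
  window from \<open>h - n\<close> (excluded) to \<open>h\<close>, which has length
  \<open>n\<close>.\<close>

lemma card_farey_neighbours:
  assumes "n \<in> {1..h}"
  shows "card {j. (n, j) \<in> farey h} = totient n"
proof -
  have "{j. (n, j) \<in> farey h} = {j \<in> {h - n<..h - n + n}. coprime j n}"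
    using assms by (auto simp: farey_def coprime_commute)
  moreover have "n > 0" using assms by simp
  ultimately show ?thesis by (simp only: card_coprime_period)
qed

lemma sum_farey_fst:
  fixes u :: "nat \<Rightarrow> real"
  shows "(\<Sum>(i, j)\<in>farey h. u i) = (\<Sum>n=1..h. totient n * u n)"
proof -
  have "(\<Sum>(i, j)\<in>farey h. u i) = (\<Sum>n\<in>{1..h}. \<Sum>j\<in>{j. (n, j) \<in> farey h}. u n)"
    by (subst sum.Sigma)
      (auto simp: farey_def intro!: sum.cong finite_subset[of "{j. _ j}" "{1..h}"])
  then show ?thesis by (simp add: card_farey_neighbours)
qed

lemma sum_farey_snd: "(\<Sum>(i, j)\<in>farey h. u j) = (\<Sum>(i, j)\<in>farey h. u i)"
  by (rule sum.reindex_bij_witness[of _ prod.swap prod.swap])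
    (auto simp: farey_def coprime_commute add.commute)

text \<open>The \<open>u n\<close> will be \<open>L\<^sub>n / n\<close>. The saving comes from adding the slacks at \<open>(p, p - d)\<close> and \<open>(p, p + d)\<close>
  and applying the constraints at \<open>(p, p)\<close> and \<open>(p - d, p + d)\<close>.\<close>

lemma totient_sum_le:
  fixes u :: "nat \<Rightarrow> real" and K :: real
  assumes "h \<ge> 1" "K \<ge> 0"
    and u: "\<And>i j. i \<in> {1..h} \<Longrightarrow> j \<in> {1..h} \<Longrightarrow> u i + u j \<le> 2 * K / (real i * real j)"
    and T: "finite T" "\<And>p d. (p, d) \<in> T \<Longrightarrow> d \<ge> 1 \<and> p + d \<le> h \<and> h + d < 2 * p \<and> coprime p d"
  shows "(\<Sum>n=1..h. totient n * u n) \<le> K - K / real h ^ 4 * (\<Sum>(p, d)\<in>T. real d ^ 2)"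
proof -
  \<comment> \<open>\<open>s\<close> is the slack of a constraint. Since the Farey weights sum to 1,
    the sum of all constraints is the claim without the saving; what remains is a lower bound for
    the total slack.\<close>
  define s where "s = (\<lambda>(i, j). 2 * K / (real i * real j) - u i - u j)"
  have s_nonneg: "s e \<ge> 0" if e_farey: "e \<in> farey h" for e
  proof -
    obtain i j where e: "e = (i, j)" "i \<in> {1..h}" "j \<in> {1..h}"
      using e_farey by (cases e) (auto simp: farey_def)
    then show ?thesis using u[of i j] by (simp add: s_def)
  qed
  have "sum s (farey h) = 2 * K * (\<Sum>(i, j)\<in>farey h. 1 / (real i * real j))
      - (\<Sum>(i, j)\<in>farey h. u i) - (\<Sum>(i, j)\<in>farey h. u j)"
    by (simp add: s_def case_prod_beta sum_subtractf sum_distrib_left)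
  then have total: "2 * (\<Sum>n=1..h. totient n * u n) = 2 * K - sum s (farey h)"
    using sum_farey[OF \<open>h \<ge> 1\<close>] by (simp add: sum_farey_snd sum_farey_fst)
  let ?f = "\<lambda>(p, d). (p, p - d)" and ?g = "\<lambda>(p, d). (p, p + d)"
  have inj: "inj_on ?f T" "inj_on ?g T"
    using T(2) by (force simp: inj_on_def)+
  have sub: "?f ` T \<union> ?g ` T \<subseteq> farey h"
  proof -
    \<comment> \<open>The hypothesis \<open>h + d < 2 * p\<close> says that even the smaller
      coordinate sum, \<open>2 * p - d\<close>, exceeds \<open>h\<close>.\<close>
    have "(p, p - d) \<in> farey h \<and> (p, p + d) \<in> farey h" if "(p, d) \<in> T" for p d
    proof -
      have "d \<le> p" "coprime p d" using T(2)[OF that] by auto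
      have "gcd (p - d) (p - d + d) = gcd (p - d) d" "gcd p (p + d) = gcd p d" by (rule gcd_add2)+
      moreover have "gcd (p - d) d = gcd p d" using \<open>d \<le> p\<close> by (rule gcd_diff1_nat)
      ultimately have "gcd (p - d) p = 1" "gcd p (p + d) = 1"
        using \<open>d \<le> p\<close> \<open>coprime p d\<close>
          by (simp_all add: coprime_iff_gcd_eq_1)
      then have "coprime p (p - d)" "coprime p (p + d)"
        by (simp_all only: coprime_iff_gcd_eq_1 gcd.commute[of p "p - d"])
      then show ?thesis using T(2)[OF that] by (auto simp: farey_def)
    qed
    then show ?thesis by auto
  qed
  have dis: "?f ` T \<inter> ?g ` T = {}"
    using T(2) by fastforce
  have triangle: "2 * (K / real h ^ 4 * real d ^ 2) \<le> s (p, p - d) + s (p, p + d)"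
    if "(p, d) \<in> T" for p d
  proof -
    have d: "d \<ge> 1" "p + d \<le> h" "h + d < 2 * p" using T(2)[OF that] by auto
    have pd: "real (p - d) = real p - real d" "real p - real d > 0" "real p > 0"
      using d by auto
    have "u p + u p \<le> 2 * K / (real p * real p)" by (rule u) (use d in auto)
    moreover have "u (p - d) + u (p + d) \<le> 2 * K / (real (p - d) * real (p + d))"
      by (rule u) (use d in auto)
    ultimately have "s (p, p - d) + s (p, p + d) \<ge> 2 * K / (real p * real (p - d)) +
       2 * K / (real p * real (p + d)) - 2 * K / (real p * real p) - 2 * K / (real (p - d) * real (p + d))"
      by (simp add: s_def)
    also have "2 * K / (real p * real (p - d)) +
       2 * K / (real p * real (p + d)) - 2 * K / (real p * real p) - 2 * K / (real (p - d) * real (p + d))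
       = 2 * K * real d ^ 2 / (real p ^ 2 * (real p ^ 2 - real d ^ 2))"
    proof -
      have nz: "real p - real d \<noteq> 0" "real p + real d \<noteq> 0" "real p \<noteq> 0"
        using pd by auto
      have "real p ^ 2 - real d ^ 2 = (real p - real d) * (real p + real d)"
        by (simp add: power2_eq_square algebra_simps)
      then show ?thesis using nz unfolding pd(1) of_nat_add
        by (simp add: divide_simps) (simp add: power2_eq_square algebra_simps)
    qed
    finally have 1: "2 * K * real d ^ 2 / (real p ^ 2 * (real p ^ 2 - real d ^ 2)) \<le> s (p, p - d) + s (p, p + d)" .
    have "real p ^ 2 * (real p ^ 2 - real d ^ 2) \<le> real h ^ 2 * real h ^ 2"
    proof (intro mult_mono)
      have "real p ^ 2 \<le> real h ^ 2" using d by (intro power_mono) auto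
      then show "real p ^ 2 \<le> real h ^ 2" "real p ^ 2 - real d ^ 2 \<le> real h ^ 2"
        using zero_le_power2[of "real d"] by linarith+
      have "real d ^ 2 \<le> real p ^ 2" using d by (intro power_mono) auto
      then show "0 \<le> real p ^ 2 - real d ^ 2" by simp
    qed auto
    then have 2: "real p ^ 2 * (real p ^ 2 - real d ^ 2) \<le> real h ^ 4" by (simp flip: power_add)
    have "real d ^ 2 < real p ^ 2" using pd by (intro power_strict_mono) auto
    then have "2 * K * real d ^ 2 / real h ^ 4 \<le> 2 * K * real d ^ 2 / (real p ^ 2 * (real p ^ 2 - real d ^ 2))"
      using 2 pd \<open>K \<ge> 0\<close> \<open>h \<ge> 1\<close>
        by (intro divide_left_mono mult_pos_pos) auto
    then show ?thesis using 1 by simp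
  qed
  have "2 * (K / real h ^ 4 * (\<Sum>(p, d)\<in>T. real d ^ 2)) = (\<Sum>(p, d)\<in>T. 2 * (K / real h ^ 4 * real d ^ 2))"
    by (simp add: sum_distrib_left case_prod_beta)
  also have "\<dots> \<le> (\<Sum>(p, d)\<in>T. s (p, p - d) + s (p, p + d))"
    using triangle by (intro sum_mono) auto
  also have "\<dots> = sum s (?f ` T) + sum s (?g ` T)"
    unfolding sum.reindex[OF inj(1)] sum.reindex[OF inj(2)]
    by (simp add: sum.distrib case_prod_beta)
  also have "\<dots> = sum s (?f ` T \<union> ?g ` T)"
    using T(1) dis by (simp add: sum.union_disjoint)
  also have "\<dots> \<le> sum s (farey h)"
    using sub s_nonneg by (intro sum_mono2 finite_farey) auto
  finally show ?thesis using total by linarith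
qed

section \<open>Unimodular maps and thin position\<close>

fun cross :: "int \<times> int \<Rightarrow> int \<times> int \<Rightarrow> int" where
  "cross (a, b) (c, d) = a * d - c * b"

lemma nice_cross_le: "nice k Q \<Longrightarrow> q \<in> Q \<Longrightarrow> q' \<in> Q \<Longrightarrow> \<bar>cross q q'\<bar> \<le> int k"
  unfolding nice_def by (cases q; cases q') fastforce

lemma nice_coprime: "nice k Q \<Longrightarrow> (m, n) \<in> Q \<Longrightarrow> coprime m n"
  unfolding nice_def by (auto simp: coprime_iff_gcd_eq_1)

lemma nice_cross_eq_0:
  assumes "nice k Q" "q \<in> Q" "q' \<in> Q" "cross q q' = 0"
  shows "q = q'"
proof -
  obtain a b c d where q: "q = (a, b)" "q' = (c, d)" by (metis surj_pair)
  have "gcd a b = 1" "gcd c d = 1" "(- a, - b) \<notin> Q"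
    using assms(1-3) unfolding q nice_def by auto
  then show ?thesis
    using primitive_parallel[of a b c d] assms(2-4) unfolding q by auto
qed

text \<open>Vectors of a nice set with zero cross product coincide, so preserving cross products up
  to sign already yields injectivity and rules out opposite images. Signs may thus be changed vector
  by vector.\<close>

lemma nice_image:
  assumes Q: "nice k Q"
    and prim: "\<And>q. q \<in> Q \<Longrightarrow> gcd (fst (f q)) (snd (f q)) = 1"
    and cross: "\<And>q q'. q \<in> Q \<Longrightarrow> q' \<in> Q \<Longrightarrow> \<bar>cross (f q) (f q')\<bar> = \<bar>cross q q'\<bar>"
  shows "nice k (f ` Q)" and "card (f ` Q) = card Q"
proof -
  have eq: "q = q'" if "q \<in> Q" "q' \<in> Q" "cross (f q) (f q') = 0" for q q'
    using nice_cross_eq_0[OF Q that(1,2)] cross[OF that(1,2)] that(3) by simp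
  have "cross q q = 0" for q by (cases q) simp
  then have "inj_on f Q" by (metis eq inj_onI)
  then show "card (f ` Q) = card Q" by (rule card_image)
  have "\<not> ((m, n) \<in> f ` Q \<and> (- m, - n) \<in> f ` Q)" for m n
  proof
    assume "(m, n) \<in> f ` Q \<and> (- m, - n) \<in> f ` Q"
    then obtain q q' where q: "q \<in> Q" "q' \<in> Q" "f q = (m, n)" "f q' = (- m, - n)"
      by (metis imageE)
    then have "q = q'" by (intro eq) auto
    then show False using prim[of q] q by auto
  qed
  moreover have "\<bar>cross x y\<bar> \<le> int k" if "x \<in> f ` Q" "y \<in> f ` Q" for x y
    using that cross nice_cross_le[OF Q] by auto
  then have "\<bar>m * n' - m' * n\<bar> \<le> int k"
    if "(m, n) \<in> f ` Q" "(m', n') \<in> f ` Q" for m n m' n'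
    using that cross.simps by metis
  moreover have "(m, n) \<noteq> (0, 0) \<and> gcd m n = 1" if "(m, n) \<in> f ` Q" for m n
  proof -
    obtain q where "q \<in> Q" "f q = (m, n)" using \<open>(m, n) \<in> f ` Q\<close> by (metis imageE)
    then have "gcd m n = 1" using prim[of q] by simp
    then show ?thesis by auto
  qed
  ultimately show "nice k (f ` Q)"
    unfolding nice_def by blast
qed

text \<open>If \<open>q1\<close>, \<open>q2\<close> have the largest cross product in absolute value
  and it is nonzero, every vector of \<open>Q\<close> has coordinates of absolute value at most 1
  with respect to them. It then suffices to find a nonzero lattice vector whose cross products with
  \<open>q1\<close> and \<open>q2\<close> are of order \<open>sqrt k\<close>.\<close>

lemma thin_direction:
  assumes Q: "nice k Q" and "k > 0"
  obtains v where "gcd (fst v) (snd v) = 1" "\<And>q. q \<in> Q \<Longrightarrow> (cross q v)\<^sup>2 \<le> 9 * int k"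
proof (cases "Q = {}")
  case True
  then show ?thesis using that[of "(1, 0)"] by simp
next
  case False
  have fin: "finite Q" using Q by (rule nice_finite)
  let ?X = "(\<lambda>(q, q'). \<bar>cross q q'\<bar>) ` (Q \<times> Q)"
  have "Max ?X \<in> ?X" using fin False by (intro Max_in) auto
  then obtain q1 q2 where q12: "q1 \<in> Q" "q2 \<in> Q" and Max: "Max ?X = \<bar>cross q1 q2\<bar>"
    by auto
  have max: "\<bar>cross q q'\<bar> \<le> \<bar>cross q1 q2\<bar>" if "q \<in> Q" "q' \<in> Q" for q q'
    using that fin by (auto simp flip: Max intro!: Max_ge)
  obtain a b c d where q: "q1 = (a, b)" "q2 = (c, d)" by (metis surj_pair)
  define \<Delta> where "\<Delta> = cross q1 q2"
  show ?thesis
  proof (cases "\<Delta> = 0")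
    case True
    \<comment> \<open>Here all cross products vanish, and \<open>q1\<close> itself serves.\<close>
    show ?thesis
    proof (rule that[of q1])
      show "gcd (fst q1) (snd q1) = 1" using nice_coprime[OF Q, of a b] q12 q by simp
      show "(cross x q1)\<^sup>2 \<le> 9 * int k" if "x \<in> Q" for x
        using max[OF that q12(1)] True by (simp add: \<Delta>_def)
    qed
  next
    case False
    have "gcd a b = 1" using nice_coprime[OF Q, of a b] q12 q by simp
    then obtain \<alpha> \<beta> where bezout: "\<alpha> * a + \<beta> * b = 1" by (metis bezout_int)
    \<comment> \<open>The vectors \<open>q1\<close> and \<open>(- \<beta>, \<alpha>)\<close> form a
      lattice basis, in which \<open>q2\<close> has coordinates \<open>e\<close> and
      \<open>\<Delta>\<close>, and \<open>v\<close> below has coordinates \<open>x\<close> and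
      \<open>y\<close>.\<close>
    define e where "e = c * \<alpha> + d * \<beta>"
    \<comment> \<open>The final bound is \<open>N + \<bar>\<Delta>\<bar> / N\<close> with
      \<open>\<bar>\<Delta>\<bar> \<le> k\<close>, which \<open>N\<close> near \<open>sqrt k\<close>
      balances; rounding up at most doubles it, giving the constant 3.\<close>
    define N where "N = nat \<lceil>sqrt k\<rceil>"
    have sqrt: "sqrt k \<ge> 1" using \<open>k > 0\<close> by simp
    have N: "N > 0" "sqrt k \<le> N" "N \<le> 2 * sqrt k" unfolding N_def using sqrt by linarith+
    \<comment> \<open>Approximating \<open>e / \<Delta>\<close> by \<open>x / y\<close> makes
      \<open>cross q2 v\<close> small, while \<open>cross q1 v\<close> is the denominator
      \<open>y\<close>.\<close>
    obtain x y where xy: "0 < y" "y \<le> int N" "\<bar>of_int y * (of_int e / of_int \<Delta>) - of_int x\<bar> < 1 / real N"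
      using Dirichlet_approx[OF N(1)] by metis
    define v where "v = (x * a - y * \<beta>, x * b + y * \<alpha>)"
    have q1v: "cross q1 v = y"
    proof -
      have "cross q1 v = y * (\<alpha> * a + \<beta> * b)" by (simp add: v_def q algebra_simps)
      then show ?thesis by (simp add: bezout)
    qed
    have q2v: "cross q2 v = y * e - x * \<Delta>"
      by (simp add: v_def q \<Delta>_def e_def algebra_simps)
    have small: "\<bar>of_int (y * e - x * \<Delta>)\<bar> \<le> \<bar>real_of_int \<Delta>\<bar> / N"
    proof -
      have "\<bar>real_of_int (y * e - x * \<Delta>)\<bar> = \<bar>real_of_int \<Delta>\<bar> * \<bar>of_int y * (of_int e / of_int \<Delta>) - of_int x\<bar>"
        using False by (simp add: abs_mult[symmetric] field_simps)
      also have "\<dots> \<le> \<bar>real_of_int \<Delta>\<bar> * (1 / N)"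
        using xy(3) by (intro mult_left_mono) auto
      finally show ?thesis by simp
    qed
    have bound: "\<bar>real_of_int (cross p v)\<bar> \<le> 3 * sqrt k" if p: "p \<in> Q" for p
    proof -
      obtain m n where mn: "p = (m, n)" by (metis surj_pair)
      \<comment> \<open>Cramer's rule: \<open>p\<close> is expanded in terms of \<open>q1\<close>
        and \<open>q2\<close>.\<close>
      have "\<Delta> * cross p v = cross p q2 * cross q1 v + cross q1 p * cross q2 v"
        by (simp add: \<Delta>_def q mn v_def algebra_simps)
      then have "\<Delta> * cross p v = cross p q2 * y + cross q1 p * (y * e - x * \<Delta>)"
        by (simp only: q1v q2v)
      then have "\<bar>real_of_int \<Delta>\<bar> * \<bar>real_of_int (cross p v)\<bar> = \<bar>real_of_int (cross p q2 * y + cross q1 p * (y * e - x * \<Delta>))\<bar>"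
        by (simp only: abs_mult[symmetric] of_int_mult[symmetric])
      also have "\<dots> \<le> \<bar>real_of_int (cross p q2)\<bar> * \<bar>real_of_int y\<bar> + \<bar>real_of_int (cross q1 p)\<bar> * \<bar>real_of_int (y * e - x * \<Delta>)\<bar>"
        by (simp only: abs_mult[symmetric] of_int_mult[symmetric] of_int_add abs_triangle_ineq)
      also have "\<dots> \<le> \<bar>real_of_int \<Delta>\<bar> * N + \<bar>real_of_int \<Delta>\<bar> * (\<bar>real_of_int \<Delta>\<bar> / N)"
      proof (intro add_mono mult_mono small)
        show "\<bar>real_of_int (cross p q2)\<bar> \<le> \<bar>real_of_int \<Delta>\<bar>" "\<bar>real_of_int (cross q1 p)\<bar> \<le> \<bar>real_of_int \<Delta>\<bar>"
          using max[OF p q12(2)] max[OF q12(1) p] by (simp_all add: \<Delta>_def flip: of_int_abs)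
        show "\<bar>real_of_int y\<bar> \<le> real N" using xy by (simp flip: of_int_abs)
      qed auto
      finally have "\<bar>real_of_int \<Delta>\<bar> * \<bar>real_of_int (cross p v)\<bar> \<le> \<bar>real_of_int \<Delta>\<bar> * (N + \<bar>real_of_int \<Delta>\<bar> / N)"
        by (simp add: algebra_simps)
      then have "\<bar>real_of_int (cross p v)\<bar> \<le> N + \<bar>real_of_int \<Delta>\<bar> / N"
        using False by simp
      also have "\<bar>real_of_int \<Delta>\<bar> / N \<le> k / sqrt k"
      proof (rule frac_le)
        show "\<bar>real_of_int \<Delta>\<bar> \<le> k"
          using nice_cross_le[OF Q q12] by (simp add: \<Delta>_def flip: of_int_abs)
      qed (use N sqrt in auto)
      also have "k / sqrt k = sqrt k" by (simp add: real_div_sqrt)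
      finally show ?thesis using N by simp
    qed
    \<comment> \<open>\<open>v\<close> may fail to be primitive; dividing by the gcd only shrinks
      the cross products.\<close>
    define g where "g = gcd (fst v) (snd v)"
    have "v \<noteq> (0, 0)" using q1v xy by (auto simp: q)
    then have g: "g > 0" unfolding g_def by (cases v) (auto simp: gcd_pos_int)
    obtain v1 v2 where v12: "fst v = g * v1" "snd v = g * v2"
      unfolding g_def by (metis dvdE gcd_dvd1 gcd_dvd2)
    show ?thesis
    proof (rule that[of "(v1, v2)"])
      have "g * gcd v1 v2 = g"
        using g unfolding g_def by (metis abs_of_pos gcd_mult_distrib_int g_def v12)
      then show "gcd (fst (v1, v2)) (snd (v1, v2)) = 1" using g by simp
      fix p assume p: "p \<in> Q"
      have "cross p v = g * cross p (v1, v2)" using v12 by (cases p; cases v) (simp add: algebra_simps)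
      then have "\<bar>cross p (v1, v2)\<bar> \<le> \<bar>cross p v\<bar>"
        using g mult_right_mono[of 1 g "\<bar>cross p (v1, v2)\<bar>"] by (simp add: abs_mult)
      then have "\<bar>real_of_int (cross p (v1, v2))\<bar> \<le> 3 * sqrt k"
        using bound[OF p] by linarith
      then have "\<bar>real_of_int (cross p (v1, v2))\<bar> ^ 2 \<le> (3 * sqrt k) ^ 2"
        by (intro power_mono) auto
      then have "real_of_int ((cross p (v1, v2))\<^sup>2) \<le> real_of_int (9 * int k)"
        by (simp add: power_mult_distrib)
      then show "(cross p (v1, v2))\<^sup>2 \<le> 9 * int k" by (simp only: of_int_le_iff)
    qed
  qed
qed

text \<open>Completing \<open>v\<close> to a lattice basis gives a map \<open>T\<close> of
  determinant -1 whose second coordinate is the cross product with \<open>v\<close>. The sign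
  \<open>\<sigma>\<close> then moves each image to the upper half plane, and on the axis to the
  positive side.\<close>

lemma thin_position:
  assumes Q: "nice k Q" and "k > 0"
  obtains Q' where "nice k Q'" "card Q' = card Q"
    "\<And>m n. (m, n) \<in> Q' \<Longrightarrow> 0 \<le> n \<and> n\<^sup>2 \<le> 9 * int k \<and> (n = 0 \<longrightarrow> m = 1)"
proof -
  obtain v where v: "gcd (fst v) (snd v) = 1" "\<And>q. q \<in> Q \<Longrightarrow> (cross q v)\<^sup>2 \<le> 9 * int k"
    using thin_direction[OF assms] by metis
  obtain x y where xy: "v = (x, y)" by (metis surj_pair)
  obtain \<alpha> \<beta> where bezout: "\<alpha> * x + \<beta> * y = 1"
    using v(1) xy by (metis bezout_int fst_conv snd_conv)
  define T where "T = (\<lambda>(m, n). (\<alpha> * m + \<beta> * n, y * m - x * n))"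
  define \<sigma> :: "int \<times> int \<Rightarrow> int" where "\<sigma> = (\<lambda>(m, n). if n < 0 \<or> n = 0 \<and> m < 0 then - 1 else 1)"
  define f where "f = (\<lambda>q. (\<sigma> (T q) * fst (T q), \<sigma> (T q) * snd (T q)))"
  have T: "cross (T q) (T q') = - cross q q'" for q q'
  proof -
    obtain a b c d where q: "q = (a, b)" "q' = (c, d)" by (metis surj_pair)
    have "cross (T q) (T q') = - (\<alpha> * x + \<beta> * y) * cross q q'"
      by (simp add: T_def q algebra_simps)
    then show ?thesis by (simp add: bezout)
  qed
  have \<sigma>: "\<bar>\<sigma> p\<bar> = 1" for p by (simp add: \<sigma>_def split: prod.split)
  have "cross (f q) (f q') = \<sigma> (T q) * \<sigma> (T q') * cross (T q) (T q')" for q q'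
    by (cases "T q"; cases "T q'") (simp add: f_def algebra_simps)
  then have cross: "\<bar>cross (f q) (f q')\<bar> = \<bar>cross q q'\<bar>" for q q'
    by (simp add: abs_mult \<sigma> T)
  have prim: "gcd (fst (f q)) (snd (f q)) = 1" if "q \<in> Q" for q
  proof -
    obtain m n where q: "q = (m, n)" by (metis surj_pair)
    have "gcd m n = 1" using nice_coprime[OF Q] that q by auto
    then obtain r s where rs: "r * m + s * n = 1" by (metis bezout_int)
    \<comment> \<open>This is \<open>r * m + s * n\<close> rewritten through the inverse of
      \<open>T\<close>, hence a Bezout relation for the coordinates of \<open>T q\<close>.\<close>
    have "(r * x + s * y) * fst (T q) + (r * \<beta> - s * \<alpha>) * snd (T q) = (\<alpha> * x + \<beta> * y) * (r * m + s * n)"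
      by (simp add: T_def q algebra_simps)
    then have "(r * x + s * y) * fst (T q) + (r * \<beta> - s * \<alpha>) * snd (T q) = 1"
      by (simp add: bezout rs)
    then have "coprime (fst (T q)) (snd (T q))"
      by (metis coprimeI dvd_add dvd_mult)
    moreover have "\<sigma> (T q) = 1 \<or> \<sigma> (T q) = - 1" using \<sigma>[of "T q"] by linarith
    ultimately show ?thesis by (auto simp: f_def)
  qed
  note img = nice_image[of k Q f, OF Q prim cross]
  show ?thesis
  proof (rule that[OF img])
    fix m n assume "(m, n) \<in> f ` Q"
    then obtain q where q: "q \<in> Q" "f q = (m, n)" by auto
    have "snd (T q) = cross q v" by (cases q) (simp add: T_def xy algebra_simps)
    moreover have "n = \<sigma> (T q) * snd (T q)" using q by (simp add: f_def)
    moreover have "\<sigma> (T q) = 1 \<or> \<sigma> (T q) = - 1" using \<sigma>[of "T q"] by linarith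
    ultimately have "n\<^sup>2 = (cross q v)\<^sup>2" by auto
    then have 1: "n\<^sup>2 \<le> 9 * int k" using v(2)[OF q(1)] by simp
    have 2: "0 \<le> n" "n = 0 \<Longrightarrow> 0 \<le> m"
      using q(2) by (auto simp: f_def \<sigma>_def split: prod.splits if_splits)
    have "gcd m n = 1" using prim[OF q(1)] q(2) by simp
    then show "0 \<le> n \<and> n\<^sup>2 \<le> 9 * int k \<and> (n = 0 \<longrightarrow> m = 1)"
      using 1 2 by auto
  qed
qed

section \<open>Rows of a set in thin position\<close>

text \<open>The constant 256 is the cube root of \<open>8 ^ 8\<close>.\<close>

lemma two_power_prime_factors_le:
  assumes "n > 0" "n \<le> h"
  shows "(2::real) ^ card (prime_factors n) \<le> 256 * root 3 (real h)"
proof (rule power_le_imp_le_base)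
  let ?w = "card (prime_factors n)"
  have "real (8 ^ ?w) \<le> real (8 ^ 8 * n)"
    using power_card_prime_factors_le[OF assms(1)] by (simp only: of_nat_le_iff)
  also have "\<dots> \<le> 8 ^ 8 * real h" using assms by simp
  also have "\<dots> = (256 * root 3 (real h)) ^ Suc 2"
    by (simp add: power_mult_distrib flip: numeral_3_eq_3)
  also have "real (8 ^ ?w) = ((2::real) ^ ?w) ^ Suc 2"
    by (simp flip: power_mult) (simp add: power_mult mult.commute)
  finally show "((2::real) ^ ?w) ^ Suc 2 \<le> (256 * root 3 (real h)) ^ Suc 2" .
qed simp

lemma totient_div_ge:
  assumes "n > 0"
  shows "real (totient n) / real n \<ge> 1 / 2 ^ card (prime_factors n)"
proof -
  have "(\<Prod>p\<in>prime_factors n. 1 / 2) \<le> (\<Prod>p\<in>prime_factors n. 1 - 1 / real p)"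
  proof (rule prod_mono)
    fix p assume "p \<in> prime_factors n"
    then have "p \<ge> 2" by (auto simp: in_prime_factors_iff prime_ge_2_nat)
    then show "0 \<le> (1 / 2 :: real) \<and> 1 / 2 \<le> 1 - 1 / real p" by (simp add: field_simps)
  qed
  then show ?thesis using assms by (simp add: totient_formula2 power_divide)
qed

text \<open>Pairs with \<open>5 h / 8 < p \<le> 6 h / 8\<close> and \<open>h / 8 < d \<le> h / 4\<close> suffice.\<close>

lemma many_coprime_pairs:
  "\<exists>H. \<forall>h\<ge>H. \<exists>T. finite T \<and>
     (\<forall>(p, d)\<in>T. d \<ge> 1 \<and> p + d \<le> h \<and> h + d < 2 * p \<and> coprime p d) \<and>
     root 3 (real h) ^ 11 / 2 ^ 22 \<le> (\<Sum>(p, d)\<in>T. real d ^ 2)"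
proof (intro exI allI impI conjI)
  \<comment> \<open>The threshold means \<open>r \<ge> 2 ^ 20\<close>, exactly what makes half of
    the main term \<open>r\<^sup>2 / 2048\<close> in the count of \<open>d\<close> absorb the sieve
    error \<open>256 * r\<close>.\<close>
  fix h :: nat assume h: "(2 ^ 20) ^ 3 \<le> h"
  define r where "r = root 3 (real h)"
  have r3: "r ^ 3 = real h" unfolding r_def by simp
  have "root 3 (real ((2 ^ 20) ^ 3)) \<le> r" unfolding r_def
    using h by (intro real_root_le_mono) (auto simp only: of_nat_le_iff)
  moreover have "root 3 (real ((2 ^ 20) ^ 3)) = 2 ^ 20"
    by (simp only: of_nat_power of_nat_numeral) (rule real_root_power_cancel, auto)
  ultimately have r: "r \<ge> 2 ^ 20" by simp
  have h16: "h \<ge> 16" using h by simp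
  define P where "P = {5 * h div 8 + 1..6 * h div 8}"
  define D where "D = (\<lambda>p. {d::nat. real h / 8 < d \<and> d \<le> real h / 4 \<and> coprime p d})"
  have finD: "finite (D p)" for p
    by (rule finite_subset[of _ "{..h}"]) (auto simp: D_def)
  have cardP: "real (card P) \<ge> real h / 16"
  proof -
    have "16 * card P \<ge> h" unfolding P_def using h16 by simp
    then show ?thesis by linarith
  qed
  have cardD: "real (card (D p)) \<ge> r\<^sup>2 / 4096" if "p \<in> P" for p
  proof -
    have p: "p > 0" "p \<le> h" using that by (auto simp: P_def)
    let ?w = "card (prime_factors p)"
    have w: "(2::real) ^ ?w \<le> 256 * r"
      using two_power_prime_factors_le[OF p] by (simp add: r_def)
    have "{m::int. real h / 8 < real_of_int m \<and> real_of_int m \<le> real h / 4 \<and> coprime m (int p)} = int ` D p"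
    proof (intro equalityI subsetI)
      fix m assume m: "m \<in> {m::int. real h / 8 < real_of_int m \<and> real_of_int m \<le> real h / 4 \<and> coprime m (int p)}"
      then have "real_of_int m > 0" by (smt (verit) mem_Collect_eq of_nat_0_le_iff divide_nonneg_nonneg)
      then obtain n where n: "m = int n" by (metis of_int_0_less_iff zero_less_imp_eq_int)
      then show "m \<in> int ` D p" using m by (auto simp: D_def coprime_commute)
    qed (auto simp: D_def coprime_commute)
    then have "card {m::int. real h / 8 < real_of_int m \<and> real_of_int m \<le> real h / 4 \<and> coprime m (int p)} = card (D p)"
      by (simp add: card_image)
    then have "\<bar>real (card (D p)) - (real h / 4 - real h / 8) * (totient p / p)\<bar> \<le> 2 ^ ?w"
      using card_coprime[OF p(1), of "real h / 8" "real h / 4"] by simp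
    then have 1: "real (card (D p)) \<ge> real h / 8 * (totient p / p) - 2 ^ ?w"
      by (simp add: field_simps)
    \<comment> \<open>The density of integers coprime to \<open>p\<close> is at least of order
      \<open>1 / r\<close>, so an interval of length \<open>h / 8\<close> contains of order
      \<open>r\<^sup>2\<close> of them.\<close>
    have "1 / (256 * r) \<le> 1 / 2 ^ ?w" using w r by (intro divide_left_mono mult_pos_pos) auto
    also have "\<dots> \<le> totient p / p" using totient_div_ge p(1) by blast
    finally have "real h / 8 * (1 / (256 * r)) \<le> real h / 8 * (totient p / p)"
      by (intro mult_left_mono) auto
    moreover have "real h / 8 * (1 / (256 * r)) = r\<^sup>2 / 2048"
      using r unfolding r3[symmetric] by (simp add: field_simps power2_eq_square power3_eq_cube)
    moreover have "r\<^sup>2 / 4096 \<ge> 256 * r"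
      using r mult_right_mono[of "2 ^ 20" r r] by (simp add: power2_eq_square)
    ultimately show ?thesis using 1 w by linarith
  qed
  show "finite (Sigma P D)" by (auto simp: P_def finD)
  show "\<forall>(p, d)\<in>Sigma P D. d \<ge> 1 \<and> p + d \<le> h \<and> h + d < 2 * p \<and> coprime p d"
  proof safe
    fix p d assume "p \<in> P" "d \<in> D p"
    then have pd: "5 * h div 8 < p" "p \<le> 6 * h div 8" "real h / 8 < d" "d \<le> real h / 4" "coprime p d"
      by (auto simp: P_def D_def)
    then have "h < 8 * d" "4 * d \<le> h" by linarith+
    then show "d \<ge> 1" "p + d \<le> h" "h + d < 2 * p" "coprime p d" using pd by linarith+
  qed
  have r_pos: "r > 0" using r by simp
  \<comment> \<open>The factors bound from below the number of \<open>p\<close>, the number of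
    \<open>d\<close> for each \<open>p\<close>, and \<open>d ^ 2\<close>.\<close>
  have "r ^ 11 / 2 ^ 22 = (real h / 16) * (r\<^sup>2 / 4096 * (real h / 8) ^ 2)"
    by (simp add: r3[symmetric] power2_eq_square) (simp add: eval_nat_numeral)
  also have "\<dots> \<le> real (card P) * (r\<^sup>2 / 4096 * (real h / 8) ^ 2)"
    by (intro mult_right_mono cardP) auto
  also have "\<dots> = (\<Sum>p\<in>P. r\<^sup>2 / 4096 * (real h / 8) ^ 2)" by simp
  also have "\<dots> \<le> (\<Sum>p\<in>P. \<Sum>d\<in>D p. real d ^ 2)"
  proof (rule sum_mono)
    fix p assume "p \<in> P"
    then have "r\<^sup>2 / 4096 * (real h / 8) ^ 2 \<le> real (card (D p)) * (real h / 8) ^ 2"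
      by (intro mult_right_mono cardD) auto
    also have "\<dots> = (\<Sum>d\<in>D p. (real h / 8) ^ 2)" by simp
    also have "\<dots> \<le> (\<Sum>d\<in>D p. real d ^ 2)"
      by (intro sum_mono power_mono) (auto simp: D_def)
    finally show "r\<^sup>2 / 4096 * (real h / 8) ^ 2 \<le> (\<Sum>d\<in>D p. real d ^ 2)" .
  qed
  also have "\<dots> = (\<Sum>(p, d)\<in>Sigma P D. real d ^ 2)"
    by (rule sum.Sigma) (auto simp: P_def finD)
  finally show "root 3 (real h) ^ 11 / 2 ^ 22 \<le> (\<Sum>(p, d)\<in>Sigma P D. real d ^ 2)"
    by (simp add: r_def)
qed

text \<open>A set in thin position that leaves the axis, cut into horizontal rows; \<open>h\<close>
  is the largest height that actually occurs.\<close>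

locale layered =
  fixes k h :: nat and Q :: "(int \<times> int) set"
  assumes nice: "nice k Q"
    and height: "\<And>m n. (m, n) \<in> Q \<Longrightarrow> 0 \<le> n \<and> n \<le> int h"
    and bottom: "\<And>m. (m, 0) \<in> Q \<Longrightarrow> m = 1"
    and top: "\<exists>m. (m, int h) \<in> Q"
    and h_pos: "h \<ge> 1"
begin

definition level :: "nat \<Rightarrow> int set" where
  "level n = {m. (m, int n) \<in> Q}"

text \<open>The value 0 on empty rows lets the width constraints hold for all rows without case
  distinction.\<close>

definition width :: "nat \<Rightarrow> int" where
  "width n = (if level n = {} then 0 else Max (level n) - Min (level n))"

lemma finite_level [simp]: "finite (level n)"
proof -
  have "level n \<subseteq> fst ` Q" by (force simp: level_def)
  then show ?thesis using nice_finite[OF nice] by (simp add: finite_subset)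
qed

lemma coprime_level: "m \<in> level n \<Longrightarrow> coprime m (int n)"
  using nice_coprime[OF nice] by (auto simp: level_def)

lemma level_cross: "m \<in> level i \<Longrightarrow> m' \<in> level j \<Longrightarrow> int j * m - int i * m' \<le> int k"
  using nice_cross_le[OF nice, of "(m, int i)" "(m', int j)"] by (simp add: level_def algebra_simps)

lemma level_bounds:
  assumes "level n \<noteq> {}"
  shows "Min (level n) \<in> level n" "Max (level n) \<in> level n" "Min (level n) \<le> Max (level n)"
    "width n = Max (level n) - Min (level n)"
  using assms by (auto simp: width_def)

lemma level_subset: "level n \<subseteq> {Min (level n)..Max (level n)}"
  by auto

lemma width_nonneg: "width n \<ge> 0"
  using level_bounds(3) by (auto simp: width_def)

lemma level_top: "level h \<noteq> {}"
  using top by (auto simp: level_def)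

text \<open>For nonempty rows, pairing the right end of each row with the left end of the other
  gives two cross product bounds, whose sum is the claim.\<close>

lemma width_le:
  assumes "i \<in> {1..h}" "j \<in> {1..h}"
  shows "int j * width i + int i * width j \<le> 2 * int k"
proof -
  have full: "int j * width i + int i * width j \<le> 2 * int k"
    if "level i \<noteq> {}" "level j \<noteq> {}" for i j
    using level_cross[OF level_bounds(2)[OF that(1)] level_bounds(1)[OF that(2)]]
      level_cross[OF level_bounds(2)[OF that(2)] level_bounds(1)[OF that(1)]]
    by (simp add: level_bounds(4) that algebra_simps)
  \<comment> \<open>An empty row has width 0, and its constraint follows from the one of the nonempty top row.\<close>
  have half: "int j * width i \<le> 2 * int k" if "level i \<noteq> {}" "j \<le> h" for i j
  proof -
    have "int j * width i \<le> int h * width i" using that by (intro mult_right_mono width_nonneg) auto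
    also have "\<dots> \<le> int h * width i + int i * width h" using width_nonneg by simp
    also have "\<dots> \<le> 2 * int k" by (rule full[OF that(1) level_top])
    finally show ?thesis .
  qed
  consider "level i = {}" "level j = {}" | "level i = {}" "level j \<noteq> {}"
    | "level i \<noteq> {}" "level j = {}" | "level i \<noteq> {}" "level j \<noteq> {}" by blast
  then show ?thesis
  proof cases
    case 1 then show ?thesis by (simp add: width_def)
  next
    case 2 then show ?thesis using half[of j i] assms by (simp add: width_def[of i])
  next
    case 3 then show ?thesis using half[of i j] assms by (simp add: width_def[of j])
  next
    case 4 then show ?thesis by (rule full)
  qed
qed

lemma card_le_levels: "card Q \<le> 1 + (\<Sum>n=1..h. card (level n))"
proof -
  have "Q \<subseteq> {(1, 0)} \<union> (\<Union>n\<in>{1..h}. (\<lambda>m. (m, int n)) ` level n)"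
  proof
    fix q assume q: "q \<in> Q"
    obtain m n where mn: "q = (m, n)" by (metis surj_pair)
    then obtain n' where n': "n = int n'" "n' \<le> h"
      using height[of m n] q by (metis of_nat_le_iff zero_le_imp_eq_int)
    show "q \<in> {(1, 0)} \<union> (\<Union>n\<in>{1..h}. (\<lambda>m. (m, int n)) ` level n)"
    proof (cases "n' = 0")
      case True then show ?thesis using bottom q mn n' by auto
    next
      case False
      then have "m \<in> level n'" "n' \<in> {1..h}" using q mn n' by (auto simp: level_def)
      then show ?thesis using mn n' by blast
    qed
  qed
  then have "card Q \<le> card ({(1, 0)} \<union> (\<Union>n\<in>{1..h}. (\<lambda>m. (m, int n)) ` level n))"
    by (intro card_mono) auto
  also have "\<dots> \<le> card {(1::int, 0::int)} + card (\<Union>n\<in>{1..h}. (\<lambda>m. (m, int n)) ` level n)"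
    by (rule card_Un_le)
  also have "card (\<Union>n\<in>{1..h}. (\<lambda>m. (m, int n)) ` level n) \<le> (\<Sum>n=1..h. card ((\<lambda>m. (m, int n)) ` level n))"
    by (rule card_UN_le) simp
  also have "\<dots> = (\<Sum>n=1..h. card (level n))"
    by (intro sum.cong card_image) (auto simp: inj_on_def)
  finally show ?thesis by simp
qed

lemma card_level_le:
  assumes "n > 0"
  shows "real (card (level n)) \<le> totient n * (width n / n) + (1 + 2 ^ card (prime_factors n))"
proof (cases "level n = {}")
  case True
  then show ?thesis by (simp add: width_def)
next
  case False
  let ?a = "Min (level n)" and ?b = "Max (level n)"
  \<comment> \<open>The interval is open on the left, so it starts at \<open>?a - 1\<close>. Its
    length is the width plus 1, and the extra unit contributes
    \<open>totient n / n \<le> 1\<close>.\<close>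
  let ?C = "{m. real_of_int (?a - 1) < real_of_int m \<and> real_of_int m \<le> real_of_int ?b \<and> coprime m (int n)}"
  have "level n \<subseteq> ?C"
  proof
    fix m assume m: "m \<in> level n"
    then have "?a - 1 < m" "m \<le> ?b"
      using Min_le[OF finite_level m] Max_ge[OF finite_level m] by linarith+
    then show "m \<in> ?C"
      using coprime_level[OF m] by (simp only: mem_Collect_eq of_int_less_iff of_int_le_iff)
  qed
  moreover have "finite ?C"
    by (rule finite_subset[of _ "{?a..?b}"]) auto
  ultimately have c1: "card (level n) \<le> card ?C" by (rule card_mono[rotated])
  have c2: "\<bar>card ?C - (of_int ?b - of_int (?a - 1)) * (totient n / n)\<bar> \<le> 2 ^ card (prime_factors n)"
    using level_bounds(3)[OF False] by (intro card_coprime assms) linarith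
  have c3: "(of_int ?b - of_int (?a - 1)) * (totient n / n) = totient n * (width n / n) + totient n / n"
    by (simp add: level_bounds(4)[OF False] diff_divide_distrib add_divide_distrib algebra_simps)
  have c4: "totient n / n \<le> 1" using assms totient_le[of n] by (simp add: field_simps)
  have "real N \<le> A + (1 + e)"
    if "N \<le> M" "\<bar>real M - B\<bar> \<le> e" "B = A + f" "f \<le> 1"
    for N M :: nat and A B e f :: real
    using that by linarith
  from this[OF c1 c2 c3 c4] show ?thesis .
qed

text \<open>The sieve bounds for the rows are summed, and \<open>totient_sum_le\<close> is applied
  to \<open>width n / n\<close>; the leading 1 counts the point \<open>(1, 0)\<close>.\<close>

lemma card_le:
  assumes T: "finite T" "\<And>p d. (p, d) \<in> T \<Longrightarrow> d \<ge> 1 \<and> p + d \<le> h \<and> h + d < 2 * p \<and> coprime p d"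
  shows "real (card Q) \<le> 1 + k - k / real h ^ 4 * (\<Sum>(p, d)\<in>T. real d ^ 2)
    + real h * (1 + 256 * root 3 (real h))"
proof -
  have "real (card Q) \<le> real (1 + (\<Sum>n=1..h. card (level n)))"
    using card_le_levels by (simp only: of_nat_le_iff)
  also have "\<dots> = 1 + (\<Sum>n=1..h. real (card (level n)))" by simp
  also have "(\<Sum>n=1..h. real (card (level n))) \<le>
      (\<Sum>n=1..h. totient n * (width n / n) + (1 + 256 * root 3 (real h)))"
  proof (rule sum_mono)
    fix n assume "n \<in> {1..h}"
    then have n: "n > 0" "n \<le> h" by auto
    show "real (card (level n)) \<le> totient n * (width n / n) + (1 + 256 * root 3 (real h))"
      using card_level_le[OF n(1)] two_power_prime_factors_le[OF n] by linarith
  qed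
  also have "\<dots> = (\<Sum>n=1..h. totient n * (width n / n)) + real h * (1 + 256 * root 3 (real h))"
    by (simp add: sum.distrib)
  also have "(\<Sum>n=1..h. totient n * (width n / n)) \<le> k - k / real h ^ 4 * (\<Sum>(p, d)\<in>T. real d ^ 2)"
  proof (rule totient_sum_le[OF h_pos _ _ T])
    fix i j assume ij: "i \<in> {1..h}" "j \<in> {1..h}"
    then have "real_of_int (int j * width i + int i * width j) \<le> real_of_int (2 * int k)"
      using width_le by (simp only: of_int_le_iff)
    then have "(real j * width i + real i * width j) / (real i * real j) \<le> 2 * real k / (real i * real j)"
      by (intro divide_right_mono) auto
    also have "(real j * width i + real i * width j) / (real i * real j) = width i / i + width j / j"
      using ij by (simp add: field_simps)
    finally show "width i / i + width j / j \<le> 2 * real k / (real i * real j)" .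
  qed auto
  finally show ?thesis by simp
qed

end

section \<open>Upper bounds by height\<close>

text \<open>The error has order \<open>h\<close> to the power 4/3. For large \<open>h\<close> the
  saving has order at least \<open>k\<close> times \<open>h\<close> to the power -1/3, hence at
  least the power 5/3 as \<open>h\<^sup>2 \<le> 9 * k\<close>. For bounded \<open>h\<close> a single
  pair saves a fixed fraction of \<open>k\<close>.\<close>

lemma card_le_if_high:
  "\<exists>k0. \<forall>k\<ge>k0. \<forall>h Q. layered k h Q \<longrightarrow> 4 \<le> h \<longrightarrow> h\<^sup>2 \<le> 9 * k \<longrightarrow> card Q \<le> k + 1"
proof -
  obtain H where H: "\<And>h. H \<le> h \<Longrightarrow> \<exists>T. finite T \<and>
     (\<forall>(p, d)\<in>T. d \<ge> 1 \<and> p + d \<le> h \<and> h + d < 2 * p \<and> coprime p d) \<and>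
     root 3 (real h) ^ 11 / 2 ^ 22 \<le> (\<Sum>(p, d)\<in>T. real d ^ 2)"
    using many_coprime_pairs by blast
  \<comment> \<open>The second entry gives \<open>r \<ge> 2 ^ 34\<close>, which exceeds
    \<open>257 * 9 * 2 ^ 22\<close>, the factor needed in the comparison of powers of
    \<open>r\<close> below.\<close>
  define G where "G = max H ((2 ^ 34) ^ 3)"
  have "card Q \<le> k + 1"
    if k: "G ^ 5 * (1 + 256 * G) \<le> k" and "layered k h Q" and h: "4 \<le> h" "h\<^sup>2 \<le> 9 * k" for k h Q
  proof -
    interpret layered k h Q by fact
    define r where "r = root 3 (real h)"
    have r3: "r ^ 3 = real h" unfolding r_def by simp
    have "\<exists>T. finite T \<and> (\<forall>(p, d)\<in>T. d \<ge> 1 \<and> p + d \<le> h \<and> h + d < 2 * p \<and> coprime p d) \<and>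
      real h * (1 + 256 * r) \<le> k / real h ^ 4 * (\<Sum>(p, d)\<in>T. real d ^ 2)"
    proof (cases "G \<le> h")
      case True
      then have "H \<le> h" "(2 ^ 34) ^ 3 \<le> h" by (simp_all only: G_def max.bounded_iff)
      then have "root 3 (real ((2 ^ 34) ^ 3)) \<le> r"
        unfolding r_def by (intro real_root_le_mono) (auto simp only: of_nat_le_iff)
      moreover have "root 3 (real ((2 ^ 34) ^ 3)) = 2 ^ 34"
        by (simp only: of_nat_power of_nat_numeral) (rule real_root_power_cancel, auto)
      ultimately have r: "r \<ge> 2 ^ 34" by simp
      obtain T where T: "finite T" "\<forall>(p, d)\<in>T. d \<ge> 1 \<and> p + d \<le> h \<and> h + d < 2 * p \<and> coprime p d"
        "r ^ 11 / 2 ^ 22 \<le> (\<Sum>(p, d)\<in>T. real d ^ 2)"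
        using H[OF \<open>H \<le> h\<close>] unfolding r_def by blast
      have "real (h\<^sup>2) \<le> real (9 * k)" using h(2) by (simp only: of_nat_le_iff)
      then have k_ge: "(r ^ 3)\<^sup>2 / 9 \<le> real k" by (simp add: r3)
      have "real h * (1 + 256 * r) \<le> real h * (257 * r)"
        using r by (intro mult_left_mono) auto
      also have "\<dots> = 257 * r ^ 4" by (simp add: r3[symmetric] eval_nat_numeral)
      also have "\<dots> \<le> r / (9 * 2 ^ 22) * r ^ 4" using r by (intro mult_right_mono) auto
      also have "\<dots> = (r ^ 3)\<^sup>2 / 9 / (r ^ 3) ^ 4 * (r ^ 11 / 2 ^ 22)"
        using r by (simp add: field_simps flip: power_mult power_add power_Suc)
      also have "\<dots> \<le> k / (r ^ 3) ^ 4 * (\<Sum>(p, d)\<in>T. real d ^ 2)"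
        using r by (intro mult_mono divide_right_mono k_ge T(3)) auto
      finally show ?thesis using T(1,2) by (auto simp: r3)
    next
      case False
      have "r \<le> real h" using self_le_power[of r 3] h by (simp add: r3) (simp add: r_def)
      then have "real h * (1 + 256 * r) \<le> real h * (1 + 256 * real h)"
        by (intro mult_left_mono) auto
      also have "\<dots> = real (h ^ 5 * (1 + 256 * h)) / real h ^ 4"
        using h by (simp add: field_simps eval_nat_numeral)
      also have "h ^ 5 * (1 + 256 * h) \<le> G ^ 5 * (1 + 256 * G)"
        using False by (intro mult_mono power_mono) auto
      then have "h ^ 5 * (1 + 256 * h) \<le> k" using k by (rule le_trans)
      then have "real (h ^ 5 * (1 + 256 * h)) / real h ^ 4 \<le> k / real h ^ 4"
        by (intro divide_right_mono) (simp_all only: of_nat_le_iff zero_le_power of_nat_0_le_iff)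
      finally have "real h * (1 + 256 * r) \<le> k / real h ^ 4" .
      \<comment> \<open>The pair \<open>(h - 1, 1)\<close> is admissible because
        \<open>h \<ge> 4\<close>; the lower bound on \<open>k\<close> was chosen so that its saving
        \<open>k / h ^ 4\<close> covers the error.\<close>
      then show ?thesis using h by (intro exI[of _ "{(h - 1, 1)}"]) auto
    qed
    then obtain T where T: "finite T" "\<forall>(p, d)\<in>T. d \<ge> 1 \<and> p + d \<le> h \<and> h + d < 2 * p \<and> coprime p d"
      "real h * (1 + 256 * r) \<le> k / real h ^ 4 * (\<Sum>(p, d)\<in>T. real d ^ 2)" by blast
    have "real (card Q) \<le> 1 + k - k / real h ^ 4 * (\<Sum>(p, d)\<in>T. real d ^ 2) + real h * (1 + 256 * r)"
      unfolding r_def using T(2) by (intro card_le T(1)) blast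
    then show ?thesis using T(3) by linarith
  qed
  then show ?thesis by blast
qed

section \<open>Exact row counts and the heights one, two and three\<close>

lemma le_div_iff:
  fixes x y q :: int
  assumes "q > 0"
  shows "x \<le> y div q \<longleftrightarrow> q * x \<le> y"
proof
  assume "x \<le> y div q"
  then have "q * x \<le> q * (y div q)" using assms by simp
  also have "\<dots> \<le> y" using assms pos_mod_sign[of q y] mult_div_mod_eq[of q y] by linarith
  finally show "q * x \<le> y" .
next
  assume "q * x \<le> y"
  then have "(q * x) div q \<le> y div q" using assms by (rule zdiv_mono1)
  then show "x \<le> y div q" using assms by simp
qed

lemma card_not_multiple:
  fixes a b q :: int
  assumes "q > 0" "a \<le> b + 1"
  shows "int (card {m \<in> {a..b}. \<not> q dvd m}) = (b - a + 1) - (b div q - (a - 1) div q)"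
proof -
  have mult: "{m \<in> {a..b}. q dvd m} = (*) q ` {(a - 1) div q + 1..b div q}"
  proof -
    have "q * m \<le> b \<longleftrightarrow> m \<le> b div q" "a \<le> q * m \<longleftrightarrow> (a - 1) div q < m" for m
      using le_div_iff[OF assms(1), of m b] le_div_iff[OF assms(1), of m "a - 1"] by linarith+
    then show ?thesis by (auto simp: image_iff dvd_def)
  qed
  have "(a - 1) div q \<le> b div q" using assms by (intro zdiv_mono1) auto
  then have "int (card {m \<in> {a..b}. q dvd m}) = b div q - (a - 1) div q"
    unfolding mult using assms(1) by (subst card_image) (auto simp: inj_on_def)
  moreover have "card {m \<in> {a..b}. \<not> q dvd m} = card {a..b} - card {m \<in> {a..b}. q dvd m}"
  proof -
    have "{m \<in> {a..b}. \<not> q dvd m} = {a..b} - {m \<in> {a..b}. q dvd m}" by auto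
    moreover have "{m \<in> {a..b}. q dvd m} \<subseteq> {a..b}" by auto
    moreover from this have "finite {m \<in> {a..b}. q dvd m}" by (rule finite_subset) simp
    ultimately show ?thesis using card_Diff_subset by metis
  qed
  moreover have "card {m \<in> {a..b}. q dvd m} \<le> card {a..b}" by (intro card_mono) auto
  ultimately show ?thesis using assms(2) by simp
qed

context layered begin

text \<open>Applied to the primes 2 and 3, where not being a multiple is the same as being coprime,
  so this replaces the sieve without loss.\<close>

lemma card_level_le_not_multiple:
  assumes "level n \<noteq> {}" "n > 1"
  shows "int (card (level n)) \<le> (Max (level n) - Min (level n) + 1)
    - (Max (level n) div int n - (Min (level n) - 1) div int n)"
proof -
  have "\<not> int n dvd m" if "m \<in> level n" for m
    using coprime_level[OF that] assms(2) coprime_common_divisor[of m "int n" "int n"] by auto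
  then have "level n \<subseteq> {m \<in> {Min (level n)..Max (level n)}. \<not> int n dvd m}"
    using level_subset by auto
  moreover have "finite {m \<in> {Min (level n)..Max (level n)}. \<not> int n dvd m}"
    by (rule finite_subset[of _ "{Min (level n)..Max (level n)}"]) auto
  ultimately have "card (level n) \<le> card {m \<in> {Min (level n)..Max (level n)}. \<not> int n dvd m}"
    by (intro card_mono)
  then show ?thesis
    using card_not_multiple[of "int n" "Min (level n)" "Max (level n)"] level_bounds(3)[OF assms(1)] assms(2)
    by linarith
qed

lemma card_level_1: "int (card (level 1)) \<le> width 1 + 1"
proof (cases "level 1 = {}")
  case False
  have "card (level 1) \<le> card {Min (level 1)..Max (level 1)}"
    by (intro card_mono level_subset) auto
  then show ?thesis
    unfolding card_atLeastAtMost_int using level_bounds(3,4)[OF False] by linarith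
qed (simp add: width_def)

lemma card_level_2: "2 * int (card (level 2)) \<le> width 2 + 2"
proof (cases "level 2 = {}")
  case False
  have "odd (Min (level 2))" "odd (Max (level 2))"
    using coprime_level[of _ 2] level_bounds[OF False] by auto
  then show ?thesis
    using card_level_le_not_multiple[OF False] level_bounds[OF False] by (auto elim!: oddE)
qed (simp add: width_def)

text \<open>The extremal case is a row that starts at residue 1 and ends at residue 2 modulo
  3.\<close>

lemma card_level_3: "3 * int (card (level 3)) \<le> 2 * width 3 + 4"
proof (cases "level 3 = {}")
  case False
  have "3 * (b - a + 1 - (b div 3 - (a - 1) div 3)) \<le> 2 * (b - a) + 4" if "a \<le> b" for a b :: int
    using that by presburger
  from this[OF level_bounds(3)[OF False]] show ?thesis
    using card_level_le_not_multiple[OF False] level_bounds(4)[OF False] by simp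
qed (simp add: width_def)

lemma card_le_if_height_1:
  assumes "h = 1"
  shows "card Q \<le> k + 2"
  using card_le_levels card_level_1 width_le[of 1 1] assms by simp

text \<open>With both rows present, the two cross products between opposite ends are odd because the
  ends of row 2 are odd. For even \<open>k\<close> they are therefore at most \<open>k - 1\<close>,
  which is where parity enters.\<close>

lemma card_le_if_height_2:
  assumes "h = 2" "k \<ge> 4"
  shows "card Q \<le> (if even k then k + 2 else k + 3)"
proof (cases "level 1 = {}")
  case True
  then show ?thesis
    using card_le_levels card_level_2 width_le[of 2 2] assms by (simp add: numeral_2_eq_2)
next
  case False
  have ne: "level 2 \<noteq> {}" using level_top assms by simp
  have "odd (Min (level 2))" "odd (Max (level 2))"
    using coprime_level[of _ 2] level_bounds[OF ne] by auto
  then obtain c d where cd: "Min (level 2) = 2 * c + 1" "Max (level 2) = 2 * d + 1"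
    by (auto elim!: oddE)
  have "2 * Max (level 1) - (2 * c + 1) \<le> int k"
    using level_cross[OF level_bounds(2)[OF False] level_bounds(1)[OF ne]] cd by simp
  moreover have "(2 * d + 1) - 2 * Min (level 1) \<le> int k"
    using level_cross[OF level_bounds(2)[OF ne] level_bounds(1)[OF False]] cd by simp
  moreover have "int (card (level 1)) \<le> Max (level 1) - Min (level 1) + 1"
    using card_level_1 level_bounds(4)[OF False] by simp
  moreover have "int (card (level 2)) \<le> d - c + 1"
    using card_level_2 level_bounds(4)[OF ne] cd by simp
  moreover have "card Q \<le> 1 + (card (level 1) + card (level 2))"
    using card_le_levels assms by (simp add: numeral_2_eq_2)
  ultimately show ?thesis by simp presburger
qed

text \<open>With all rows present, the cross bounds for the Farey pairs of height 3, that is row 3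
  against rows 1 and 2, are rounded down separately and added. The result depends only on
  \<open>k\<close> modulo 6 and on the end residues of row 3 modulo 3.\<close>

lemma card_le_if_height_3:
  assumes "h = 3" "k \<ge> 24"
  shows "card Q \<le> (if k mod 6 = 2 then k + 4 else if k mod 6 \<in> {1, 3, 5} then k + 3 else k + 2)"
proof (cases "level 1 = {} \<or> level 2 = {}")
  case True
  \<comment> \<open>A missing row loses a positive fraction of \<open>k\<close>, so the bounds by
    widths suffice.\<close>
  have "int (card Q) \<le> int k + 2"
    using True card_le_levels card_level_1 card_level_2 card_level_3
      width_le[of 1 3] width_le[of 2 2] width_le[of 3 3] width_nonneg[of 3] assms
    by (auto simp: numeral_3_eq_3 numeral_2_eq_2)
  then show ?thesis by auto
next
  case False
  have ne: "level 1 \<noteq> {}" "level 2 \<noteq> {}" "level 3 \<noteq> {}"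
    using False level_top assms by auto
  have "odd (Min (level 2))" "odd (Max (level 2))"
    using coprime_level[of _ 2] level_bounds[OF ne(2)] by auto
  then obtain c d where cd: "Min (level 2) = 2 * c + 1" "Max (level 2) = 2 * d + 1"
    by (auto elim!: oddE)
  have "\<not> 3 dvd m" if "m \<in> level 3" for m
    using coprime_level[OF that] coprime_common_divisor[of m "int 3" "int 3"] by auto
  then have "\<not> 3 dvd Min (level 3)" "\<not> 3 dvd Max (level 3)"
    using level_bounds[OF ne(3)] by auto
  then have "\<exists>a. Min (level 3) = 3 * a + 1 \<or> Min (level 3) = 3 * a + 2"
    "\<exists>b. Max (level 3) = 3 * b + 1 \<or> Max (level 3) = 3 * b + 2" by presburger+
  then obtain a b \<rho> \<tau> where ab: "Min (level 3) = 3 * a + \<rho>" "Max (level 3) = 3 * b + \<tau>"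
    and \<rho>\<tau>: "\<rho> = 1 \<or> \<rho> = 2" "\<tau> = 1 \<or> \<tau> = 2" by metis
  \<comment> \<open>Splitting off \<open>6 * t\<close> leaves quotients by 3 and 6 that involve only
    the residues \<open>\<kappa>\<close>, \<open>\<rho>\<close> and \<open>\<tau>\<close>.\<close>
  define t \<kappa> where "t = int k div 6" and "\<kappa> = int k mod 6"
  have k: "int k = 6 * t + \<kappa>" by (simp add: t_def \<kappa>_def)
  have divI: "x \<le> y div q" if "q * x \<le> y" "q > 0" for x y q :: int
    using that by (simp add: le_div_iff)
  have "3 * Max (level 1) - (3 * a + \<rho>) \<le> int k"
    using level_cross[OF level_bounds(2)[OF ne(1)] level_bounds(1)[OF ne(3)]] ab by simp
  then have 1: "Max (level 1) - 2 * t - a \<le> (\<kappa> + \<rho>) div 3" using k by (intro divI) auto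
  have "(3 * b + \<tau>) - 3 * Min (level 1) \<le> int k"
    using level_cross[OF level_bounds(2)[OF ne(3)] level_bounds(1)[OF ne(1)]] ab by simp
  then have 2: "b - 2 * t - Min (level 1) \<le> (\<kappa> - \<tau>) div 3" using k by (intro divI) auto
  have "3 * (2 * d + 1) - 2 * (3 * a + \<rho>) \<le> int k"
    using level_cross[OF level_bounds(2)[OF ne(2)] level_bounds(1)[OF ne(3)]] ab cd by simp
  then have 3: "d - t - a \<le> (\<kappa> + 2 * \<rho> - 3) div 6" using k by (intro divI) auto
  have "2 * (3 * b + \<tau>) - 3 * (2 * c + 1) \<le> int k"
    using level_cross[OF level_bounds(2)[OF ne(3)] level_bounds(1)[OF ne(2)]] ab cd by simp
  then have 4: "b - c - t \<le> (\<kappa> + 3 - 2 * \<tau>) div 6" using k by (intro divI) auto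
  have 5: "int (card (level 1)) \<le> Max (level 1) - Min (level 1) + 1"
    using card_level_1 level_bounds(4)[OF ne(1)] by simp
  have 6: "int (card (level 2)) \<le> d - c + 1"
    using card_level_2 level_bounds(4)[OF ne(2)] cd by simp
  have "(3 * b + \<tau>) div 3 = b" "(3 * a + \<rho> - 1) div 3 = a" using \<rho>\<tau> by auto
  then have 7: "int (card (level 3)) \<le> 2 * (b - a) + \<tau> - \<rho> + 1"
    using card_level_le_not_multiple[OF ne(3)] ab by simp
  have card: "card Q \<le> 1 + (card (level 1) + card (level 2) + card (level 3))"
    using card_le_levels assms by (simp add: numeral_3_eq_3 numeral_2_eq_2)
  \<comment> \<open>All row ends cancel: the four bounds contain \<open>a\<close> and
    \<open>b\<close> twice and the ends of rows 1 and 2 once, just as the three row counts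
    do.\<close>
  have total: "int (card Q) \<le> 6 * t + 4 + \<tau> - \<rho> + ((\<kappa> + \<rho>) div 3 + (\<kappa> - \<tau>) div 3
      + (\<kappa> + 2 * \<rho> - 3) div 6 + (\<kappa> + 3 - 2 * \<tau>) div 6)"
  proof -
    have "int n \<le> 6 * t + 4 + \<tau> - \<rho> + (w + x + y + z)"
      if "n \<le> 1 + (n1 + n2 + n3)" "M - 2 * t - a \<le> w" "b - 2 * t - m \<le> x" "d - t - a \<le> y" "b - c - t \<le> z"
        "int n1 \<le> M - m + 1" "int n2 \<le> d - c + 1" "int n3 \<le> 2 * (b - a) + \<tau> - \<rho> + 1"
      for n n1 n2 n3 :: nat and M m w x y z
    proof -
      have "int n \<le> 1 + (int n1 + int n2 + int n3)" using that(1) by linarith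
      then show ?thesis using that(2-) by presburger
    qed
    from this[OF card 1 2 3 4 5 6 7] show ?thesis .
  qed
  \<comment> \<open>It remains to check 24 combinations of residues.\<close>
  have "\<kappa> \<in> {0, 1, 2, 3, 4, 5}" unfolding \<kappa>_def by auto
  then have "int (card Q) \<le> int k + (if \<kappa> = 2 then 4 else if \<kappa> \<in> {1, 3, 5} then 3 else 2)"
    using total \<rho>\<tau> unfolding k by auto
  moreover have "\<kappa> = int (k mod 6)" unfolding \<kappa>_def by (simp add: zmod_int)
  ultimately show ?thesis by (auto split: if_splits)
qed

end

text \<open>After passing to thin position, the largest height decides which of the bounds above
  applies.\<close>

lemma upper_bound:
  "\<exists>k0. \<forall>k\<ge>k0. \<forall>Q. nice k Q \<longrightarrow>
     card Q \<le> (if k mod 6 = 2 then k + 4 else if k mod 6 \<in> {1, 3, 5} then k + 3 else k + 2)"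
proof -
  obtain K where K: "\<And>k h Q. K \<le> k \<Longrightarrow> layered k h Q \<Longrightarrow> 4 \<le> h \<Longrightarrow> h\<^sup>2 \<le> 9 * k \<Longrightarrow> card Q \<le> k + 1"
    using card_le_if_high by blast
  have "card Q \<le> (if k mod 6 = 2 then k + 4 else if k mod 6 \<in> {1, 3, 5} then k + 3 else k + 2)"
    (is "_ \<le> ?bound") if k: "max K 24 \<le> k" and "nice k Q" for k Q
  proof -
    have "k > 0" using k by simp
    obtain Q' where Q': "nice k Q'" "card Q' = card Q"
      and pos: "\<And>m n. (m, n) \<in> Q' \<Longrightarrow> 0 \<le> n \<and> n\<^sup>2 \<le> 9 * int k \<and> (n = 0 \<longrightarrow> m = 1)"
      using thin_position[OF \<open>nice k Q\<close> \<open>k > 0\<close>] by metis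
    have le: "k + 2 \<le> ?bound" by simp
    show ?thesis
    proof (cases "Q' \<subseteq> {(1, 0)}")
      case True
      then have "card Q' \<le> card {(1::int, 0::int)}" by (intro card_mono) auto
      then show ?thesis using Q'(2) le by simp
    next
      case False
      then obtain m1 n1 where mn1: "(m1, n1) \<in> Q'" "n1 \<noteq> 0" using pos by fastforce
      have fin: "finite (snd ` Q')" using nice_finite[OF Q'(1)] by simp
      define h where "h = nat (Max (snd ` Q'))"
      have max: "n \<le> Max (snd ` Q')" if "(m, n) \<in> Q'" for m n
        using that fin by (intro Max_ge) force+
      have "n1 \<ge> 1" using pos[OF mn1(1)] mn1(2) by simp
      then have h: "int h = Max (snd ` Q')" "h \<ge> 1" unfolding h_def using max[OF mn1(1)] by auto
      have "Max (snd ` Q') \<in> snd ` Q'" using mn1 by (intro Max_in fin) auto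
      then obtain m0 where top: "(m0, int h) \<in> Q'" using h(1) by auto
      have layered: "layered k h Q'"
        using Q'(1) pos max h top by unfold_locales auto
      have "(int h)\<^sup>2 \<le> 9 * int k" using pos[OF top] by simp
      then have "int (h\<^sup>2) \<le> int (9 * k)" by simp
      then have "h\<^sup>2 \<le> 9 * k" by (simp only: of_nat_le_iff)
      consider "h = 1" | "h = 2" | "h = 3" | "h \<ge> 4" using h(2) by linarith
      then have "card Q' \<le> ?bound"
      proof cases
        case 1
        then show ?thesis using layered.card_le_if_height_1[OF layered] le by simp
      next
        case 2
        then have "card Q' \<le> (if even k then k + 2 else k + 3)"
          using layered.card_le_if_height_2[OF layered] k by simp
        moreover have "odd k \<Longrightarrow> k mod 6 \<in> {1, 3, 5}" by simp presburger
        ultimately show ?thesis using le by (auto split: if_splits)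
      next
        case 3
        then show ?thesis using layered.card_le_if_height_3[OF layered] k by simp
      next
        case 4
        then have "card Q' \<le> k + 1"
          using K[of k h Q'] layered k \<open>h\<^sup>2 \<le> 9 * k\<close> by simp
        then show ?thesis using le by simp
      qed
      then show ?thesis using Q'(2) by simp
    qed
  qed
  then show ?thesis by blast
qed

section \<open>Optimal sets\<close>

text \<open>The normalisation to the upper half plane excludes opposite vectors, and swapping the
  two vectors turns the one-sided inequality into one for the absolute value.\<close>

lemma niceI:
  assumes "\<And>m n. (m, n) \<in> Q \<Longrightarrow> 0 \<le> n \<and> coprime m n \<and> (n = 0 \<longrightarrow> m = 1)"
    and "\<And>m n m' n'. (m, n) \<in> Q \<Longrightarrow> (m', n') \<in> Q \<Longrightarrow> m * n' - m' * n \<le> int k"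
  shows "nice k Q"
proof -
  have "(m, n) \<noteq> (0, 0) \<and> gcd m n = 1" if "(m, n) \<in> Q" for m n
    using assms(1)[OF that] by (auto simp: coprime_iff_gcd_eq_1)
  moreover have "(- m, - n) \<notin> Q" if "(m, n) \<in> Q" for m n
    using assms(1)[OF that] assms(1)[of "- m" "- n"] by auto
  moreover have "\<bar>m * n' - m' * n\<bar> \<le> int k"
    if "(m, n) \<in> Q" "(m', n') \<in> Q" for m n m' n'
    using assms(2)[OF that] assms(2)[OF that(2,1)] by linarith
  ultimately show ?thesis unfolding nice_def by blast
qed

lemma nice_two_levels:
  assumes "k \<ge> 1"
  shows "\<exists>Q. nice k Q \<and> card Q = k + 2"
proof (intro exI conjI)
  let ?Q = "insert (1, 0) ((\<lambda>m. (m, 1)) ` {0..int k}) :: (int \<times> int) set"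
  show "nice k ?Q" using assms by (intro niceI) auto
  show "card ?Q = k + 2"
    by (subst card_insert_disjoint) (auto simp: card_image inj_on_def)
qed

lemma nice_three_levels:
  assumes "odd k" "k \<ge> 3"
  shows "\<exists>Q. nice k Q \<and> card Q = k + 3"
proof (intro exI conjI)
  \<comment> \<open>The point \<open>(int k, 2)\<close> lies over the midpoint \<open>k / 2\<close>
    of the row at height 1; it is primitive since \<open>k\<close> is odd.\<close>
  let ?Q = "insert (int k, 2) (insert (1, 0) ((\<lambda>m. (m, 1)) ` {0..int k})) :: (int \<times> int) set"
  have "coprime (int k) 2" using assms(1) by simp
  then show "nice k ?Q" using assms by (intro niceI) auto
  show "card ?Q = k + 3"
    by (subst card_insert_disjoint, simp, force, subst card_insert_disjoint)
      (auto simp: card_image inj_on_def)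
qed

text \<open>The rows make all four rounded bounds of \<open>card_le_if_height_3\<close> tight, with
  residue 1 at the left and 2 at the right end of row 3, the extremal choice for
  \<open>k mod 6 = 2\<close>.\<close>

lemma nice_four_levels:
  assumes "k mod 6 = 2" "k \<ge> 8"
  shows "\<exists>Q. nice k Q \<and> card Q = k + 4"
proof -
  define t where "t = int (k div 6)"
  \<comment> \<open>The parameter \<open>r\<close> shifts length between the rows: row 2 requires
    \<open>t \<le> 2 * r + 1\<close>, and row 3 requires \<open>9 * r + 3 \<le> 6 * t + 2\<close>.
    Half of \<open>t\<close> meets both.\<close>
  define r where "r = t div 2"
  have k: "int k = 6 * t + 2" using assms(1) unfolding t_def by presburger
  have t: "t \<ge> 1" using assms(2) k by linarith
  have r: "2 * r \<le> t" "t \<le> 2 * r + 1" unfolding r_def by linarith+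
  define S1 where "S1 = (\<lambda>m::int. (m, 1::int)) ` {r - 2 * t..2 * t + 1}"
  define S2 where "S2 = (\<lambda>c::int. (2 * c + 1, 2::int)) ` {r - t..t}"
  define S3 where "S3 = (\<lambda>a::int. (3 * a + 1, 3::int)) ` {0..r}"
  define S4 where "S4 = (\<lambda>a::int. (3 * a + 2, 3::int)) ` {0..r}"
  define Q where "Q = insert (1, 0) (S1 \<union> S2 \<union> S3 \<union> S4)"
  have "nice k Q"
  proof (rule niceI)
    fix m n assume mn: "(m, n) \<in> Q"
    have "coprime (3 * a + 1) (3::int)" "coprime (3 * a + 2) (3::int)" for a
    proof -
      have "c dvd (3 * a + 1) - 3 * a" if "c dvd 3 * a + 1" "c dvd 3" for c
        using that by (intro dvd_diff dvd_mult2)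
      then show "coprime (3 * a + 1) (3::int)" by (intro coprimeI) simp
      have "c dvd 3 * (a + 1) - (3 * a + 2)" if "c dvd 3 * a + 2" "c dvd 3" for c
        using that by (intro dvd_diff dvd_mult2)
      then show "coprime (3 * a + 2) (3::int)" by (intro coprimeI) simp
    qed
    then show "0 \<le> n \<and> coprime m n \<and> (n = 0 \<longrightarrow> m = 1)"
      using mn by (auto simp: Q_def S1_def S2_def S3_def S4_def)
  next
    fix m n m' n' assume "(m, n) \<in> Q" "(m', n') \<in> Q"
    then show "m * n' - m' * n \<le> int k"
      unfolding k using t r by (auto simp: Q_def S1_def S2_def S3_def S4_def)
  qed
  moreover have "card Q = k + 4"
  proof -
    have fin: "finite S1" "finite S2" "finite S3" "finite S4"
      by (auto simp: S1_def S2_def S3_def S4_def)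
    have disj: "(1, 0) \<notin> S1 \<union> S2 \<union> S3 \<union> S4" "S1 \<inter> S2 = {}" "(S1 \<union> S2) \<inter> S3 = {}" "(S1 \<union> S2 \<union> S3) \<inter> S4 = {}"
      unfolding S1_def S2_def S3_def S4_def by (auto, presburger)
    have "card Q = Suc (card S1 + card S2 + card S3 + card S4)"
      unfolding Q_def using fin disj by (simp add: card_Un_disjoint)
    moreover have "int (card S1) = 4 * t - r + 2" "int (card S2) = 2 * t - r + 1"
      "int (card S3) = r + 1" "int (card S4) = r + 1"
      unfolding S1_def S2_def S3_def S4_def using t r by (subst card_image; auto simp: inj_on_def)+
    ultimately show ?thesis using k by linarith
  qed
  ultimately show ?thesis by blast
qed

theorem theorem20:
  "\<exists>k0 > 0. \<forall>k \<ge> k0. max_nice_size k =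
     (if k mod 6 = 2 then k + 4
      else if k mod 6 \<in> {1, 3, 5} then k + 3
      else k + 2)"
proof -
  obtain K where K: "\<And>k Q. K \<le> k \<Longrightarrow> nice k Q \<Longrightarrow>
     card Q \<le> (if k mod 6 = 2 then k + 4 else if k mod 6 \<in> {1, 3, 5} then k + 3 else k + 2)"
    using upper_bound by blast
  have "max_nice_size k = (if k mod 6 = 2 then k + 4 else if k mod 6 \<in> {1, 3, 5} then k + 3 else k + 2)"
    (is "_ = ?bound") if k: "max K 8 \<le> k" for k
  proof -
    have "\<exists>Q. nice k Q \<and> card Q = ?bound"
    proof -
      have "odd k" if "k mod 6 \<in> {1, 3, 5}" using that by simp presburger
      then show ?thesis
        using nice_two_levels[of k] nice_three_levels[of k] nice_four_levels[of k] k by auto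
    qed
    then have "?bound \<in> {card Q | Q. nice k Q}" by (metis (mono_tags, lifting) mem_Collect_eq)
    moreover have "n \<le> ?bound" if "n \<in> {card Q | Q. nice k Q}" for n
      using that K[of k] k by (elim CollectE exE conjE) simp
    ultimately show ?thesis
      unfolding max_nice_size_def by (intro Max_eqI nice_sizes_finite)
  qed
  then show ?thesis by (intro exI[of _ "max K 8"]) simp
qed

end
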